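(* Let $\mathcal{A}$ be a unital $C^*$-algebra and let $\mathcal{B},\mathcal{C}$ be von Neumann algebras, with $\mathcal{B}\subseteq\mathscr{B}(\mathcal{H})$ for a Hilbert space $\mathcal{H}$. Let $\xi:\mathcal{B}\to\mathcal{C}$ be a non-zero normal completely positive map. Let $\varphi,\psi:\mathcal{A}\to\mathcal{B}$ be two completely positive maps. Suppose $\varphi$ is quasi-pure, $\xi\circ\varphi$ is a non-zero map, $\varphi(I)=\psi(I)$, and $\varphi$ and $\psi$ are equal almost everywhere with respect to $\xi$. Then $\varphi=\psi$.
   Context: $I$ denotes the unit of $\mathcal{A}$. The null ideal of $\xi$ is $\mathcal{N}_\xi:=\{X\in\mathcal{B}:\xi(X^*X)=0\}$. The maps $\varphi,\psi$ are equal almost everywhere with respect to $\xi$ if $\varphi(X)-\psi(X)\in\mathcal{N}_\xi$ for every $X\in\mathcal{A}$. For a completely positive (CP) map $\varphi:\mathcal{A}\to\mathscr{B}(\mathcal{H})$, a minimal Stinespring triple $(\mathcal{K},\pi,V)$ consists of a Hilbert space $\mathcal{K}$, a unital $*$-representation $\pi:\mathcal{A}\to\mathscr{B}(\mathcal{K})$ and a bounded linear map $V:\mathcal{H}\to\mathcal{K}$ such that $\varphi(X)=V^*\pi(X)V$ for all $X\in\mathcal{A}$ and $\overline{\mathrm{span}}\{\pi(X)Vh: X\in\mathcal{A},h\in\mathcal{H}\}=\mathcal{K}$. The CP map $\varphi$ is called quasi-pure if every non-zero vector in the range of $V$ is cyclic for $\pi$, that is, $\mathcal{K}=\overline{\mathrm{span}}\{\pi(X)g: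 X\in\mathcal{A}\}$ for every $0\neq g\in V(\mathcal{H})$. A CP map $\varphi:\mathcal{A}\to\mathcal{B}\subseteq\mathscr{B}(\mathcal{H})$ is called quasi-pure if it is quasi-pure as a map into $\mathscr{B}(\mathcal{H})$. *)

theory Defs
  imports "HOL-Analysis.Analysis"
begin

section \<open>Complex Hilbert spaces\<close>

class complex_vector = real_vector +
  fixes scaleC :: "complex \<Rightarrow> 'a \<Rightarrow> 'a"  (infixr "*\<^sub>C" 75)
  assumes scaleC_add_right: "a *\<^sub>C (x + y) = a *\<^sub>C x + a *\<^sub>C y"
    and scaleC_add_left: "(a + b) *\<^sub>C x = a *\<^sub>C x + b *\<^sub>C x"
    and scaleC_scaleC: "a *\<^sub>C b *\<^sub>C x = (a * b) *\<^sub>C x"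
    and scaleC_one: "1 *\<^sub>C x = x"
    and scaleR_scaleC: "r *\<^sub>R x = complex_of_real r *\<^sub>C x"

class complex_normed_vector = complex_vector + real_normed_vector +
  assumes norm_scaleC: "norm (a *\<^sub>C x) = cmod a * norm x"

text \<open>The inner product is conjugate-linear in its first argument.\<close>

class complex_inner = complex_normed_vector +
  fixes cinner :: "'a \<Rightarrow> 'a \<Rightarrow> complex"
  assumes cinner_commute: "cinner x y = cnj (cinner y x)"
    and cinner_add_right: "cinner x (y + z) = cinner x y + cinner x z"
    and cinner_scaleC_right: "cinner x (a *\<^sub>C y) = a * cinner x y"
    and cinner_self: "cinner x x = complex_of_real ((norm x)\<^sup>2)"

class chilbert_space = complex_inner + complete_space

global_interpretation complex_vector: vector_space "scaleC :: complex \<Rightarrow> 'a::complex_vector \<Rightarrow> 'a"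
  defines cspan = complex_vector.span
  by unfold_locales
    (simp_all add: scaleC_add_right scaleC_add_left scaleC_scaleC scaleC_one)

definition clinear_on :: "'a::complex_vector set \<Rightarrow> ('a \<Rightarrow> 'b::complex_vector) \<Rightarrow> bool" where
  "clinear_on S f \<longleftrightarrow>
     (\<forall>x\<in>S. \<forall>y\<in>S. f (x + y) = f x + f y) \<and> (\<forall>a. \<forall>x\<in>S. f (a *\<^sub>C x) = a *\<^sub>C f x)"

definition bounded_clinear :: "('a::complex_normed_vector \<Rightarrow> 'b::complex_normed_vector) \<Rightarrow> bool" where
  "bounded_clinear f \<longleftrightarrow> clinear_on UNIV f \<and> (\<exists>K. \<forall>x. norm (f x) \<le> K * norm x)"

text \<open>For a bounded operator between Hilbert spaces the adjoint exists by the Riesz representation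
  theorem; it is unique because the inner product is definite.\<close>

definition cadjoint :: "('a::chilbert_space \<Rightarrow> 'b::chilbert_space) \<Rightarrow> 'b \<Rightarrow> 'a" where
  "cadjoint T = (THE S. \<forall>x y. cinner (S x) y = cinner x (T y))"


section \<open>Unital C*-algebras\<close>

class adjoint =
  fixes adj :: "'a \<Rightarrow> 'a"

text \<open>The unit is taken from \<^class>\<open>monoid_mult\<close> rather than \<^class>\<open>ring_1\<close>, so that the
  zero algebra is not excluded.\<close>

class unital_cstar_algebra =
  complex_normed_vector + real_normed_algebra + monoid_mult + complete_space + adjoint +
  assumes scaleC_mult_left: "(a *\<^sub>C x) * y = a *\<^sub>C (x * y)"
    and scaleC_mult_right: "x * (a *\<^sub>C y) = a *\<^sub>C (x * y)"
    and adj_adj: "adj (adj x) = x"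
    and adj_add: "adj (x + y) = adj x + adj y"
    and adj_scaleC: "adj (a *\<^sub>C x) = cnj a *\<^sub>C adj x"
    and adj_mult: "adj (x * y) = adj y * adj x"
    and cstar_identity: "norm (adj x * x) = (norm x)\<^sup>2"


section \<open>Bounded operators on a Hilbert space\<close>

typedef (overloaded) 'h bop = "{T :: 'h::complex_normed_vector \<Rightarrow> 'h. bounded_clinear T}"
  morphisms bop_apply Bop
  by (rule exI[of _ "\<lambda>x. 0"])
    (auto simp: bounded_clinear_def clinear_on_def intro: exI[of _ 0])

setup_lifting type_definition_bop

lemma bop_eqI: "(\<And>x. bop_apply S x = bop_apply T x) \<Longrightarrow> S = T"
  by (metis bop_apply_inject ext)

lemma bounded_clinear_bop_apply: "bounded_clinear (bop_apply T)"
  using bop_apply by auto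

lemma bop_apply_add: "bop_apply T (x + y) = bop_apply T x + bop_apply T y"
  using bounded_clinear_bop_apply[of T] by (simp add: bounded_clinear_def clinear_on_def)

lemma bop_apply_scaleC: "bop_apply T (a *\<^sub>C x) = a *\<^sub>C bop_apply T x"
  using bounded_clinear_bop_apply[of T] by (simp add: bounded_clinear_def clinear_on_def)

lemma bounded_clinear_zero: "bounded_clinear (\<lambda>x. 0)"
  by (auto simp: bounded_clinear_def clinear_on_def intro: exI[of _ 0])

lemma bounded_clinear_ident: "bounded_clinear (\<lambda>x. x)"
  by (auto simp: bounded_clinear_def clinear_on_def intro: exI[of _ 1])

lemma bounded_clinear_add:
  assumes "bounded_clinear f" and "bounded_clinear g"
  shows "bounded_clinear (\<lambda>x. f x + g x)"
proof -
  obtain K L where K: "\<And>x. norm (f x) \<le> K * norm x" and L: "\<And>x. norm (g x) \<le> L * norm x"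
    using assms by (auto simp: bounded_clinear_def)
  have "norm (f x + g x) \<le> (K + L) * norm x" for x
    using norm_triangle_ineq[of "f x" "g x"] K[of x] L[of x] by (simp add: distrib_right)
  then have "\<exists>M. \<forall>x. norm (f x + g x) \<le> M * norm x"
    by blast
  with assms show ?thesis
    by (simp add: bounded_clinear_def clinear_on_def complex_vector.scale_right_distrib add_ac)
qed

lemma bounded_clinear_scaleC:
  assumes "bounded_clinear f"
  shows "bounded_clinear (\<lambda>x. a *\<^sub>C f x)"
proof -
  obtain K where K: "\<And>x. norm (f x) \<le> K * norm x"
    using assms by (auto simp: bounded_clinear_def)
  have "norm (a *\<^sub>C f x) \<le> (cmod a * K) * norm x" for x
    using mult_left_mono[OF K[of x], of "cmod a"] by (simp add: norm_scaleC mult.assoc)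
  then have "\<exists>M. \<forall>x. norm (a *\<^sub>C f x) \<le> M * norm x"
    by blast
  with assms show ?thesis
    by (simp add: bounded_clinear_def clinear_on_def complex_vector.scale_right_distrib mult.commute)
qed

lemma bounded_clinear_uminus: "bounded_clinear f \<Longrightarrow> bounded_clinear (\<lambda>x. - f x)"
  using bounded_clinear_scaleC[of f "- 1"] by simp

lemma bounded_clinear_diff:
  "bounded_clinear f \<Longrightarrow> bounded_clinear g \<Longrightarrow> bounded_clinear (\<lambda>x. f x - g x)"
  using bounded_clinear_add[of f "\<lambda>x. - g x"] bounded_clinear_uminus[of g] by simp

lemma bounded_clinear_compose:
  assumes "bounded_clinear f" and "bounded_clinear g"
  shows "bounded_clinear (\<lambda>x. f (g x))"
proof -
  obtain K L where K: "\<And>x. norm (f x) \<le> K * norm x" and L: "\<And>x. norm (g x) \<le> L * norm x"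
    using assms by (auto simp: bounded_clinear_def)
  have "norm (f (g x)) \<le> (\<bar>K\<bar> * L) * norm x" for x
  proof -
    have "norm (f (g x)) \<le> \<bar>K\<bar> * norm (g x)"
      using K[of "g x"] by (meson abs_ge_self mult_right_mono norm_ge_zero order_trans)
    also have "\<dots> \<le> \<bar>K\<bar> * (L * norm x)"
      by (intro mult_left_mono L) simp
    finally show ?thesis by (simp add: mult.assoc)
  qed
  then have "\<exists>M. \<forall>x. norm (f (g x)) \<le> M * norm x"
    by blast
  with assms show ?thesis
    by (simp add: bounded_clinear_def clinear_on_def)
qed

instantiation bop :: (complex_normed_vector) "{complex_vector, ring, monoid_mult}"
begin

lift_definition zero_bop :: "'a bop" is "\<lambda>x. 0"
  by (rule bounded_clinear_zero)
lift_definition one_bop :: "'a bop" is "\<lambda>x. x"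
  by (rule bounded_clinear_ident)
lift_definition plus_bop :: "'a bop \<Rightarrow> 'a bop \<Rightarrow> 'a bop" is "\<lambda>S T x. S x + T x"
  by (rule bounded_clinear_add)
lift_definition uminus_bop :: "'a bop \<Rightarrow> 'a bop" is "\<lambda>T x. - T x"
  by (rule bounded_clinear_uminus)
lift_definition minus_bop :: "'a bop \<Rightarrow> 'a bop \<Rightarrow> 'a bop" is "\<lambda>S T x. S x - T x"
  by (rule bounded_clinear_diff)
lift_definition times_bop :: "'a bop \<Rightarrow> 'a bop \<Rightarrow> 'a bop" is "\<lambda>S T x. S (T x)"
  by (rule bounded_clinear_compose)
lift_definition scaleC_bop :: "complex \<Rightarrow> 'a bop \<Rightarrow> 'a bop" is "\<lambda>a T x. a *\<^sub>C T x"
  by (rule bounded_clinear_scaleC)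
definition scaleR_bop :: "real \<Rightarrow> 'a bop \<Rightarrow> 'a bop" where
  "scaleR_bop r T = complex_of_real r *\<^sub>C T"

instance
proof
  fix S T U :: "'a bop" and a b :: complex and r s :: real
  show "S + T + U = S + (T + U)" "S + T = T + S" "0 + S = S" "- S + S = 0" "S - T = S + - T"
    by (transfer; simp add: add_ac fun_eq_iff)+
  show "S * T * U = S * (T * U)" "1 * S = S" "S * 1 = S" "(S + T) * U = S * U + T * U"
    by (transfer; simp add: fun_eq_iff)+
  show "S * (T + U) = S * T + S * U"
    by (transfer; simp add: fun_eq_iff bounded_clinear_def clinear_on_def)
  show *: "a *\<^sub>C (S + T) = a *\<^sub>C S + a *\<^sub>C T" "(a + b) *\<^sub>C S = a *\<^sub>C S + b *\<^sub>C S"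
    "a *\<^sub>C b *\<^sub>C S = (a * b) *\<^sub>C S" "1 *\<^sub>C S = S" for a b
    by (transfer; simp add: fun_eq_iff scaleC_add_right scaleC_add_left)+
  show "r *\<^sub>R S = complex_of_real r *\<^sub>C S"
    by (simp add: scaleR_bop_def)
  show "r *\<^sub>R (S + T) = r *\<^sub>R S + r *\<^sub>R T" "(r + s) *\<^sub>R S = r *\<^sub>R S + s *\<^sub>R S"
    "r *\<^sub>R s *\<^sub>R S = (r * s) *\<^sub>R S" "1 *\<^sub>R S = S"
    by (simp_all add: scaleR_bop_def *)
qed

end

instantiation bop :: (chilbert_space) adjoint
begin
definition adj_bop :: "'a bop \<Rightarrow> 'a bop" where
  "adj_bop T = Bop (cadjoint (bop_apply T))"
instance ..
end


section \<open>Von Neumann algebras\<close>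

definition unital_star_subalgebra ::
    "'a::{complex_vector, ring, monoid_mult, adjoint} set \<Rightarrow> bool" where
  "unital_star_subalgebra M \<longleftrightarrow>
     1 \<in> M \<and> (\<forall>S\<in>M. \<forall>T\<in>M. S + T \<in> M \<and> S * T \<in> M) \<and>
     (\<forall>a. \<forall>T\<in>M. a *\<^sub>C T \<in> M) \<and> (\<forall>T\<in>M. adj T \<in> M)"

definition commutant :: "'a::times set \<Rightarrow> 'a set" where
  "commutant M = {T. \<forall>S\<in>M. T * S = S * T}"

definition von_neumann_algebra :: "'h::chilbert_space bop set \<Rightarrow> bool" where
  "von_neumann_algebra M \<longleftrightarrow> unital_star_subalgebra M \<and> commutant (commutant M) = M"


section \<open>Completely positive maps\<close>

text \<open>An \<open>n \<times> n\<close> matrix over a (concrete or abstract) C*-algebra with carrier \<open>M\<close> is a function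
  \<^typ>\<open>nat \<Rightarrow> nat \<Rightarrow> 'a\<close> of which only the entries with indices below \<open>n\<close> count. It is positive in
  the matrix algebra over \<open>M\<close> iff it is of the form \<open>Y\<^sup>* Y\<close>.\<close>

definition positive_matrix ::
    "'a::{comm_monoid_add, times, adjoint} set \<Rightarrow> nat \<Rightarrow> (nat \<Rightarrow> nat \<Rightarrow> 'a) \<Rightarrow> bool" where
  "positive_matrix M n X \<longleftrightarrow>
     (\<exists>Y. (\<forall>i<n. \<forall>j<n. Y i j \<in> M) \<and> (\<forall>i<n. \<forall>j<n. X i j = (\<Sum>k<n. adj (Y k i) * Y k j)))"

definition completely_positive ::
    "'a::{complex_vector, times, adjoint} set \<Rightarrow> 'b::{complex_vector, times, adjoint} set \<Rightarrow>
      ('a \<Rightarrow> 'b) \<Rightarrow> bool" where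
  "completely_positive M N \<phi> \<longleftrightarrow>
     \<phi> \<in> M \<rightarrow> N \<and> clinear_on M \<phi> \<and>
     (\<forall>n X. positive_matrix M n X \<longrightarrow> positive_matrix N n (\<lambda>i j. \<phi> (X i j)))"


section \<open>Normal maps\<close>

definition op_le :: "'h::chilbert_space bop \<Rightarrow> 'h bop \<Rightarrow> bool" where
  "op_le S T \<longleftrightarrow> (\<forall>x. cinner x (bop_apply (T - S) x) \<in> \<real>\<^sub>\<ge>\<^sub>0)"

definition self_adjoint_part :: "'a::adjoint set \<Rightarrow> 'a set" where
  "self_adjoint_part M = {T \<in> M. adj T = T}"

definition op_lub :: "'h::chilbert_space bop set \<Rightarrow> 'h bop set \<Rightarrow> 'h bop \<Rightarrow> bool" where
  "op_lub M D S \<longleftrightarrow>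
     S \<in> self_adjoint_part M \<and> (\<forall>T\<in>D. op_le T S) \<and>
     (\<forall>U\<in>self_adjoint_part M. (\<forall>T\<in>D. op_le T U) \<longrightarrow> op_le S U)"

text \<open>Normality of a positive map: it preserves suprema of bounded increasing nets of self-adjoint
  elements. Nets are replaced by their ranges, which are the upward directed sets.\<close>

definition normal_map ::
    "'h::chilbert_space bop set \<Rightarrow> 'g::chilbert_space bop set \<Rightarrow> ('h bop \<Rightarrow> 'g bop) \<Rightarrow> bool" where
  "normal_map M N \<xi> \<longleftrightarrow>
     (\<forall>D S. D \<noteq> {} \<and> D \<subseteq> self_adjoint_part M \<and>
        (\<forall>T\<in>D. \<forall>U\<in>D. \<exists>W\<in>D. op_le T W \<and> op_le U W) \<and> op_lub M D S \<longrightarrow>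
        op_lub N (\<xi> ` D) (\<xi> S))"


section \<open>Almost everywhere equality\<close>

definition null_ideal ::
    "'h::chilbert_space bop set \<Rightarrow> ('h bop \<Rightarrow> 'g::chilbert_space bop) \<Rightarrow> 'h bop set" where
  "null_ideal B \<xi> = {X \<in> B. \<xi> (adj X * X) = 0}"

definition equal_ae ::
    "'h::chilbert_space bop set \<Rightarrow> ('h bop \<Rightarrow> 'g::chilbert_space bop) \<Rightarrow>
      ('a \<Rightarrow> 'h bop) \<Rightarrow> ('a \<Rightarrow> 'h bop) \<Rightarrow> bool" where
  "equal_ae B \<xi> \<phi> \<psi> \<longleftrightarrow> (\<forall>X. \<phi> X - \<psi> X \<in> null_ideal B \<xi>)"


section \<open>Stinespring triples and quasi-pure maps\<close>

definition unital_star_representation ::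
    "('a::unital_cstar_algebra \<Rightarrow> 'k::chilbert_space bop) \<Rightarrow> bool" where
  "unital_star_representation \<pi> \<longleftrightarrow>
     clinear_on UNIV \<pi> \<and> (\<forall>X Y. \<pi> (X * Y) = \<pi> X * \<pi> Y) \<and> (\<forall>X. \<pi> (adj X) = adj (\<pi> X)) \<and> \<pi> 1 = 1"

text \<open>The Hilbert space of the triple is the whole type \<^typ>\<open>'k\<close>.\<close>

definition minimal_stinespring ::
    "('a::unital_cstar_algebra \<Rightarrow> 'h::chilbert_space bop) \<Rightarrow>
      ('a \<Rightarrow> 'k::chilbert_space bop) \<Rightarrow> ('h \<Rightarrow> 'k) \<Rightarrow> bool" where
  "minimal_stinespring \<phi> \<pi> V \<longleftrightarrow>
     unital_star_representation \<pi> \<and> bounded_clinear V \<and>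
     (\<forall>X h. bop_apply (\<phi> X) h = cadjoint V (bop_apply (\<pi> X) (V h))) \<and>
     closure (cspan {bop_apply (\<pi> X) (V h) | X h. True}) = UNIV"

definition cyclic_vector ::
    "('a::unital_cstar_algebra \<Rightarrow> 'k::chilbert_space bop) \<Rightarrow> 'k \<Rightarrow> bool" where
  "cyclic_vector \<pi> g \<longleftrightarrow> closure (cspan {bop_apply (\<pi> X) g | X. True}) = UNIV"

text \<open>HOL cannot quantify over types inside a formula, so the Hilbert space \<^typ>\<open>'k\<close> carrying the
  minimal Stinespring triple is a type argument; a theorem assuming \<open>quasi_pure TYPE('k) \<phi>\<close> holds for
  all \<^typ>\<open>'k\<close>. As minimal triples are unique up to unitary equivalence, it does not matter which
  one is chosen.\<close>

definition quasi_pure ::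
    "'k::chilbert_space itself \<Rightarrow> ('a::unital_cstar_algebra \<Rightarrow> 'h::chilbert_space bop) \<Rightarrow> bool" where
  "quasi_pure _ \<phi> \<longleftrightarrow>
     (\<exists>(\<pi> :: 'a \<Rightarrow> 'k bop) V. minimal_stinespring \<phi> \<pi> V \<and>
        (\<forall>g \<in> range V. g \<noteq> 0 \<longrightarrow> cyclic_vector \<pi> g))"

end

theory Submission
  imports Defs
begin

text \<open>
  The null ideal of a normal completely positive map \<open>\<xi>\<close> on a von Neumann algebra has a greatest
  projection \<open>Q\<close>: it satisfies \<open>\<xi> Q = 0\<close>, and \<open>X * Q = X\<close> for every \<open>X\<close> in the null ideal
  (\<open>support_projection_exists\<close>). So \<open>\<phi>\<close> and \<open>\<psi>\<close> agree on every vector of the range of \<open>1 - Q\<close>. If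
  the Stinespring operator \<open>V\<close> of \<open>\<phi>\<close> vanished on that range, then \<open>\<phi> X = \<phi> X * Q\<close> for all \<open>X\<close>, and
  \<open>\<xi> (\<phi> X)\<close> would be zero by the Cauchy-Schwarz argument of \<open>map_mult_null\<close>. Hence there is a vector
  \<open>h\<close> with \<open>V h \<noteq> 0\<close> and \<open>\<phi> X h = \<psi> X h\<close> for all \<open>X\<close>, and quasi-purity makes \<open>V h\<close> cyclic for the
  Stinespring representation \<open>\<pi>\<close>.

  From there the equality propagates (\<open>cp_eq_of_cyclic_vector\<close>). Approximate \<open>V g\<close> by \<open>\<pi> Y (V h)\<close>. In
  the Stinespring space of \<open>\<psi>\<close> the vectors belonging to \<open>Y \<otimes> h\<close> and \<open>1 \<otimes> g\<close> are at the very same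
  distance as \<open>\<pi> Y (V h)\<close> and \<open>V g\<close>: expanding the square of the distance yields only terms \<open>\<psi> Z h\<close> and
  \<open>\<psi> 1\<close>, where \<open>\<psi>\<close> can be replaced by \<open>\<phi>\<close>. So \<open>\<psi> X g\<close> and \<open>\<phi> X g\<close> are both weak limits of
  \<open>\<psi> (X * Y) h = \<phi> (X * Y) h\<close>. The Stinespring space of \<open>\<psi>\<close> itself never has to be built, since
  complete positivity supplies, for the finitely many elements involved, operators \<open>W k i\<close> with
  \<open>\<psi> (X\<^sub>i\<^sup>* X\<^sub>j) = (\<Sum>k. (W k i)\<^sup>* W k j)\<close> (\<open>completely_positive_gram\<close>).

  The projection \<open>Q\<close> is the limit of the increasing net \<open>1 - (1 + a)\<^sup>-\<^sup>1\<close>, where \<open>a\<close> runs through the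
  positive elements of the null ideal. This net needs neither functional calculus nor square roots:
  sums of such \<open>a\<close> make it directed, \<open>a \<mapsto> (1 + a)\<^sup>-\<^sup>1\<close> is decreasing by a completion of the square, and
  \<open>1 - (1 + a)\<^sup>-\<^sup>1 = (1 + a)\<^sup>-\<^sup>1 * a\<close> is annihilated by \<open>\<xi>\<close>. Normality turns this into \<open>\<xi> Q = 0\<close>.
\<close>

section \<open>Complex inner product spaces\<close>

lemma cinner_add_left: "cinner (x + y) z = cinner x z + cinner y z"
  by (subst (1 2 3) cinner_commute) (simp add: cinner_add_right)

lemma cinner_scaleC_left: "cinner (a *\<^sub>C x) y = cnj a * cinner x y"
  by (subst (1 2) cinner_commute) (simp add: cinner_scaleC_right)

lemma cinner_zero_right [simp]: "cinner x 0 = 0"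
  using cinner_add_right[of x 0 0] by simp

lemma cinner_zero_left [simp]: "cinner 0 x = 0"
  using cinner_add_left[of 0 0 x] by simp

lemma cinner_diff_right: "cinner x (y - z) = cinner x y - cinner x z"
  using cinner_add_right[of x "y - z" z] by simp

lemma cinner_diff_left: "cinner (x - y) z = cinner x z - cinner y z"
  using cinner_add_left[of "x - y" y z] by simp

lemma cinner_sum_right: "cinner x (\<Sum>i\<in>I. f i) = (\<Sum>i\<in>I. cinner x (f i))"
  by (induction I rule: infinite_finite_induct) (simp_all add: cinner_add_right)

lemma Re_cinner_commute: "Re (cinner x y) = Re (cinner y x)"
  by (subst cinner_commute) simp

lemma norm_square_eq_Re_cinner: "(norm x)\<^sup>2 = Re (cinner x x)"
  by (simp only: cinner_self Re_complex_of_real)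

lemma norm_diff_square: "(norm (x - y))\<^sup>2 = (norm x)\<^sup>2 + (norm y)\<^sup>2 - 2 * Re (cinner x y)"
  using Re_cinner_commute[of x y]
  by (simp add: norm_square_eq_Re_cinner cinner_diff_left cinner_diff_right)

lemma norm_add_square: "(norm (x + y))\<^sup>2 = (norm x)\<^sup>2 + (norm y)\<^sup>2 + 2 * Re (cinner x y)"
proof -
  have "cinner x (- y) = - cinner x y"
    using cinner_diff_right[of x 0 y] by simp
  then show ?thesis
    using norm_diff_square[of x "- y"] by simp
qed

lemma parallelogram_law: "(norm (x + y))\<^sup>2 + (norm (x - y))\<^sup>2 = 2 * (norm x)\<^sup>2 + 2 * (norm y)\<^sup>2"
  for x y :: "'a::complex_inner"
  by (simp add: norm_diff_square norm_add_square)

text \<open>The scalar is the one for which \<open>x - c *\<^sub>C y\<close> is orthogonal to \<open>y\<close>.\<close>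

lemma norm_diff_projection_square:
  assumes "y \<noteq> 0"
  shows "(norm (x - (cinner y x / complex_of_real ((norm y)\<^sup>2)) *\<^sub>C y))\<^sup>2 = (norm x)\<^sup>2 - (cmod (cinner y x))\<^sup>2 / (norm y)\<^sup>2"
proof -
  let ?z = "cinner y x"
  have "cinner x ((?z / complex_of_real ((norm y)\<^sup>2)) *\<^sub>C y) = ?z * cnj ?z / complex_of_real ((norm y)\<^sup>2)"
    by (simp add: cinner_scaleC_right cinner_commute[of x y])
  also have "\<dots> = complex_of_real ((cmod ?z)\<^sup>2 / (norm y)\<^sup>2)"
    by (simp only: complex_norm_square of_real_divide)
  finally have "Re (cinner x ((?z / complex_of_real ((norm y)\<^sup>2)) *\<^sub>C y)) = (cmod ?z)\<^sup>2 / (norm y)\<^sup>2"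
    by (metis Re_complex_of_real)
  moreover have "(norm ((?z / complex_of_real ((norm y)\<^sup>2)) *\<^sub>C y))\<^sup>2 = (cmod ?z)\<^sup>2 / (norm y)\<^sup>2"
    using assms by (simp add: norm_scaleC norm_divide norm_power norm_mult power2_eq_square)
  ultimately show ?thesis
    by (simp add: norm_diff_square)
qed

lemma cinner_Cauchy_Schwarz: "cmod (cinner x y) \<le> norm x * norm y"
proof (cases "x = 0")
  case False
  have "(cmod (cinner x y))\<^sup>2 / (norm x)\<^sup>2 \<le> (norm y)\<^sup>2"
    using norm_diff_projection_square[OF False, of y]
    by (metis diff_ge_0_iff_ge zero_le_power2)
  then have "(cmod (cinner x y))\<^sup>2 \<le> (norm x * norm y)\<^sup>2"
    using False by (simp add: divide_le_eq power_mult_distrib mult.commute)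
  then show ?thesis
    by (rule power2_le_imp_le) simp
qed simp

lemma Re_cinner_le: "Re (cinner x y) \<le> norm x * norm y"
  using cinner_Cauchy_Schwarz[of x y] complex_Re_le_cmod[of "cinner x y"] by linarith

lemma cinner_ext:
  assumes "\<And>z. cinner z x = cinner z y"
  shows "x = y"
  using assms[of "x - y"] cinner_self[of "x - y"] by (simp add: cinner_diff_right)

lemma cinner_ext_left:
  assumes "\<And>z. cinner x z = cinner y z"
  shows "x = y"
  using assms[of "x - y"] cinner_self[of "x - y"] by (simp add: cinner_diff_left)

section \<open>Orthogonal decomposition and adjoints\<close>

text \<open>A minimising sequence for the distance from \<open>x\<close> to \<open>M\<close> is Cauchy by the parallelogram law,
  because midpoints stay in \<open>M\<close>; the residual of the minimiser is orthogonal to \<open>M\<close>, since otherwise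
  subtracting its component along an element of \<open>M\<close> would decrease the distance.\<close>

lemma orthogonal_decomposition:
  fixes x :: "'a::chilbert_space"
  assumes M: "complex_vector.subspace M" and cl: "closed M"
  obtains m where "m \<in> M" and "\<And>y. y \<in> M \<Longrightarrow> cinner y (x - m) = 0"
proof -
  define d where "d = infdist x M"
  have ne: "M \<noteq> {}" and "d \<ge> 0"
    using complex_vector.subspace_0[OF M] by (auto simp: d_def infdist_nonneg)
  have low: "d \<le> norm (x - y)" if "y \<in> M" for y
    using infdist_le[OF that, of x] by (simp add: d_def dist_norm)
  have "\<exists>y\<in>M. norm (x - y) < e" if "d < e" for e
    using that ne unfolding d_def infdist_notempty[OF ne]
    by (subst (asm) cInf_less_iff) (auto simp: dist_norm intro: bdd_belowI[of _ 0])
  then have "\<exists>y\<in>M. (norm (x - y))\<^sup>2 < d\<^sup>2 + inverse (real (Suc n))" for n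
  proof -
    have "d < sqrt (d\<^sup>2 + inverse (real (Suc n)))"
      using \<open>d \<ge> 0\<close> by (intro real_less_rsqrt) simp
    then obtain y where "y \<in> M" "norm (x - y) < sqrt (d\<^sup>2 + inverse (real (Suc n)))"
      using \<open>\<And>e. d < e \<Longrightarrow> \<exists>y\<in>M. norm (x - y) < e\<close> by blast
    moreover from this have "(norm (x - y))\<^sup>2 < (sqrt (d\<^sup>2 + inverse (real (Suc n))))\<^sup>2"
      by (intro power_strict_mono) auto
    ultimately show ?thesis
      by (auto simp: add_nonneg_nonneg)
  qed
  then obtain s where s: "\<And>n. s n \<in> M" "\<And>n. (norm (x - s n))\<^sup>2 < d\<^sup>2 + inverse (real (Suc n))"
    by metis
  have close: "(norm (s m - s n))\<^sup>2 \<le> 2 * inverse (real (Suc m)) + 2 * inverse (real (Suc n))" for m n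
  proof -
    have mid: "(1/2) *\<^sub>R (s m + s n) \<in> M"
      by (simp add: scaleR_scaleC s(1) M complex_vector.subspace_add complex_vector.subspace_scale)
    have "(x - s m) + (x - s n) = 2 *\<^sub>R (x - (1/2) *\<^sub>R (s m + s n))"
      by (simp add: algebra_simps scaleR_2)
    then have "(norm ((x - s m) + (x - s n)))\<^sup>2 = 4 * (norm (x - (1/2) *\<^sub>R (s m + s n)))\<^sup>2"
      by (simp add: power_mult_distrib)
    also have "\<dots> \<ge> 4 * d\<^sup>2"
      using power_mono[OF low[OF mid] \<open>d \<ge> 0\<close>, of 2] by simp
    finally have "(norm ((x - s m) + (x - s n)))\<^sup>2 \<ge> 4 * d\<^sup>2" .
    moreover have "norm ((x - s m) - (x - s n)) = norm (s m - s n)"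
      by (simp add: norm_minus_commute)
    ultimately show ?thesis
      using parallelogram_law[of "x - s m" "x - s n"] s(2)[of m] s(2)[of n] by simp
  qed
  have "Cauchy s"
  proof (rule CauchyI)
    fix e :: real
    assume "e > 0"
    then obtain N where N: "inverse (real (Suc N)) < e\<^sup>2 / 4"
      using reals_Archimedean[of "e\<^sup>2 / 4"] by auto
    have "norm (s m - s n) < e" if "m \<ge> N" "n \<ge> N" for m n
    proof -
      have "inverse (real (Suc m)) \<le> inverse (real (Suc N))" "inverse (real (Suc n)) \<le> inverse (real (Suc N))"
        using that by (intro le_imp_inverse_le; simp)+
      then have "(norm (s m - s n))\<^sup>2 < e\<^sup>2"
        using close[of m n] N by linarith
      then show ?thesis
        using \<open>e > 0\<close> by (simp add: power2_less_imp_less)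
    qed
    then show "\<exists>N. \<forall>m\<ge>N. \<forall>n\<ge>N. norm (s m - s n) < e"
      by blast
  qed
  then obtain l where l: "s \<longlonglongrightarrow> l"
    by (auto simp: Cauchy_convergent_iff convergent_def)
  have "l \<in> M"
    using cl l s(1) closed_sequentially by blast
  have "(norm (x - l))\<^sup>2 \<le> d\<^sup>2"
  proof (rule LIMSEQ_le)
    show "(\<lambda>n. (norm (x - s n))\<^sup>2) \<longlonglongrightarrow> (norm (x - l))\<^sup>2"
      by (intro tendsto_intros l)
    have "(\<lambda>n. d\<^sup>2 + inverse (real (Suc n))) \<longlonglongrightarrow> d\<^sup>2 + 0"
      by (intro tendsto_intros LIMSEQ_inverse_real_of_nat)
    then show "(\<lambda>n. d\<^sup>2 + inverse (real (Suc n))) \<longlonglongrightarrow> d\<^sup>2"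
      by simp
    show "\<exists>N. \<forall>n\<ge>N. (norm (x - s n))\<^sup>2 \<le> d\<^sup>2 + inverse (real (Suc n))"
      using s(2) less_imp_le by blast
  qed
  have "cinner y (x - l) = 0" if "y \<in> M" for y
  proof (cases "y = 0")
    case False
    let ?c = "cinner y (x - l) / complex_of_real ((norm y)\<^sup>2)"
    have "l + ?c *\<^sub>C y \<in> M"
      using \<open>l \<in> M\<close> that M by (simp add: complex_vector.subspace_add complex_vector.subspace_scale)
    then have "d\<^sup>2 \<le> (norm (x - (l + ?c *\<^sub>C y)))\<^sup>2"
      using low \<open>d \<ge> 0\<close> by (intro power_mono) auto
    also have "x - (l + ?c *\<^sub>C y) = (x - l) - ?c *\<^sub>C y"
      by simp
    also have "(norm \<dots>)\<^sup>2 = (norm (x - l))\<^sup>2 - (cmod (cinner y (x - l)))\<^sup>2 / (norm y)\<^sup>2"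
      using norm_diff_projection_square[OF False] by simp
    finally have "(cmod (cinner y (x - l)))\<^sup>2 / (norm y)\<^sup>2 \<le> 0"
      using \<open>(norm (x - l))\<^sup>2 \<le> d\<^sup>2\<close> by linarith
    then show ?thesis
      using False by (simp add: divide_le_0_iff)
  qed simp
  with \<open>l \<in> M\<close> show thesis
    by (rule that)
qed

lemma bounded_clinear_add_apply: "bounded_clinear f \<Longrightarrow> f (x + y) = f x + f y"
  and bounded_clinear_scaleC_apply: "bounded_clinear f \<Longrightarrow> f (a *\<^sub>C x) = a *\<^sub>C f x"
  by (simp_all add: bounded_clinear_def clinear_on_def)

lemma bounded_clinear_diff_apply: "bounded_clinear f \<Longrightarrow> f (x - y) = f x - f y"
  by (metis add_diff_cancel_right' bounded_clinear_add_apply diff_add_cancel)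

lemma bounded_clinear_pos_bound:
  assumes "bounded_clinear f"
  obtains K where "K > 0" and "\<And>x. norm (f x) \<le> K * norm x"
proof -
  obtain K where K: "\<And>x. norm (f x) \<le> K * norm x"
    using assms by (auto simp: bounded_clinear_def)
  have "norm (f x) \<le> (\<bar>K\<bar> + 1) * norm x" for x
    using K[of x] by (meson abs_ge_self add_increasing2 mult_right_mono norm_ge_zero order_trans zero_le_one)
  then show thesis
    by (intro that[of "\<bar>K\<bar> + 1"]) simp_all
qed

lemma bounded_clinear_imp_bounded_linear:
  assumes "bounded_clinear f"
  shows "bounded_linear f"
proof -
  obtain K where "\<And>x. norm (f x) \<le> K * norm x"
    using assms by (auto simp: bounded_clinear_def)
  then show ?thesis
    using assms
    by (intro bounded_linear_intro[of f K])
      (simp_all add: scaleR_scaleC bounded_clinear_add_apply bounded_clinear_scaleC_apply mult.commute)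
qed

text \<open>A vector \<open>n \<noteq> 0\<close> orthogonal to the kernel of \<open>f\<close> is orthogonal to \<open>f n \<cdot> x - f x \<cdot> n\<close> for every
  \<open>x\<close>, which expresses \<open>f x\<close> as a fixed multiple of \<open>\<langle>n, x\<rangle>\<close>.\<close>

lemma Riesz_representation:
  fixes f :: "'a::chilbert_space \<Rightarrow> complex"
  assumes add: "\<And>x y. f (x + y) = f x + f y" and scale: "\<And>a x. f (a *\<^sub>C x) = a * f x"
    and bound: "\<And>x. cmod (f x) \<le> K * norm x"
  shows "\<exists>z. \<forall>x. f x = cinner z x"
proof (cases "\<forall>x. f x = 0")
  case True
  then show ?thesis
    by (intro exI[of _ 0]) simp
next
  case False
  then obtain x0 where "f x0 \<noteq> 0" by blast
  have f0: "f 0 = 0" using add[of 0 0] by simp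
  have fdiff: "f (x - y) = f x - f y" for x y
    using add[of "x - y" y] by simp
  have "bounded_linear f"
    using add scale bound
    by (intro bounded_linear_intro[of f K]) (simp_all add: scaleR_scaleC scaleR_conv_of_real mult.commute)
  then have cl: "closed {x. f x = 0}"
    by (intro closed_Collect_eq continuous_on_const linear_continuous_on)
  have sub: "complex_vector.subspace {x. f x = 0}"
    by (rule complex_vector.subspaceI; simp only: mem_Collect_eq f0 add scale; simp)
  obtain m where "m \<in> {x. f x = 0}" and ortho: "\<And>y. y \<in> {x. f x = 0} \<Longrightarrow> cinner y (x0 - m) = 0"
    by (rule orthogonal_decomposition[OF sub cl, of x0]) blast
  then have m: "f m = 0" "\<And>y. f y = 0 \<Longrightarrow> cinner y (x0 - m) = 0"
    by simp_all
  define n where "n = x0 - m"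
  have "f n \<noteq> 0"
    using m(1) \<open>f x0 \<noteq> 0\<close> by (simp add: n_def fdiff)
  then have "n \<noteq> 0"
    using f0 by auto
  have "f x = cinner ((cnj (f n) / (norm n)\<^sup>2) *\<^sub>C n) x" for x
  proof -
    have "cinner (f n *\<^sub>C x - f x *\<^sub>C n) n = 0"
      using m(2)[of "f n *\<^sub>C x - f x *\<^sub>C n"] by (simp add: fdiff scale n_def)
    then have "cinner n (f n *\<^sub>C x - f x *\<^sub>C n) = 0"
      by (subst cinner_commute) simp
    then have "f n * cinner n x = f x * (norm n)\<^sup>2"
      by (simp add: cinner_diff_right cinner_scaleC_right cinner_self)
    then show ?thesis
      using \<open>n \<noteq> 0\<close> by (simp add: cinner_scaleC_left field_simps)
  qed
  then show ?thesis
    by blast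
qed

lemma cinner_cadjoint_left:
  fixes T :: "'a::chilbert_space \<Rightarrow> 'b::chilbert_space"
  assumes "bounded_clinear T"
  shows "cinner (cadjoint T x) y = cinner x (T y)"
proof -
  obtain K where K: "\<And>x. norm (T x) \<le> K * norm x"
    using bounded_clinear_pos_bound[OF assms] by metis
  have "\<exists>z. \<forall>y. cinner x (T y) = cinner z y" for x
  proof (rule Riesz_representation)
    show "cmod (cinner x (T y)) \<le> (norm x * K) * norm y" for y
      using cinner_Cauchy_Schwarz[of x "T y"] mult_left_mono[OF K[of y], of "norm x"]
      by (simp add: mult.assoc)
  qed (simp_all add: bounded_clinear_add_apply[OF assms] bounded_clinear_scaleC_apply[OF assms]
      cinner_add_right cinner_scaleC_right)
  then have "\<forall>x. \<exists>z. \<forall>y. cinner x (T y) = cinner z y"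
    by blast
  from choice[OF this] obtain S where S: "\<And>x y. cinner (S x) y = cinner x (T y)"
    by auto
  have "S' = S" if "\<forall>x y. cinner (S' x) y = cinner x (T y)" for S'
  proof
    show "S' x = S x" for x
      by (rule cinner_ext_left) (simp add: S that)
  qed
  then have "cadjoint T = S"
    unfolding cadjoint_def by (rule the_equality[rotated]) (simp_all add: S)
  with S[of x y] show ?thesis
    by (simp only:)
qed

lemma cinner_cadjoint_right:
  "bounded_clinear T \<Longrightarrow> cinner x (cadjoint T y) = cinner (T x) y"
  by (simp add: cinner_cadjoint_left cinner_commute[of x] cinner_commute[of "T x"])

lemma bounded_clinear_cadjoint:
  fixes T :: "'a::chilbert_space \<Rightarrow> 'b::chilbert_space"
  assumes "bounded_clinear T"
  shows "bounded_clinear (cadjoint T)"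
proof -
  obtain K where "K > 0" and K: "\<And>x. norm (T x) \<le> K * norm x"
    using bounded_clinear_pos_bound[OF assms] by metis
  have "norm (cadjoint T x) \<le> K * norm x" for x
  proof -
    let ?s = "cadjoint T x"
    have "(norm ?s)\<^sup>2 = Re (cinner x (T ?s))"
      by (simp add: norm_square_eq_Re_cinner cinner_cadjoint_left[OF assms])
    also have "\<dots> \<le> norm x * norm (T ?s)"
      by (rule Re_cinner_le)
    also have "\<dots> \<le> norm x * (K * norm ?s)"
      by (intro mult_left_mono K) simp
    finally have "norm ?s * norm ?s \<le> (K * norm x) * norm ?s"
      by (simp add: power2_eq_square mult_ac)
    then show ?thesis
      using \<open>K > 0\<close> by (cases "norm ?s = 0") (auto simp: mult_le_cancel_right)
  qed
  moreover have "clinear_on UNIV (cadjoint T)"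
    unfolding clinear_on_def
    by (intro conjI ballI allI; rule cinner_ext)
      (simp_all only: cinner_cadjoint_right[OF assms] cinner_add_right cinner_scaleC_right)
  ultimately show ?thesis
    unfolding bounded_clinear_def by blast
qed

section \<open>Bounded operators\<close>

lemmas bop_apply_simps [simp] =
  zero_bop.rep_eq one_bop.rep_eq plus_bop.rep_eq minus_bop.rep_eq times_bop.rep_eq scaleC_bop.rep_eq

lemma bop_apply_zero [simp]: "bop_apply T 0 = 0"
  using bop_apply_add[of T 0 0] by simp

lemma bop_apply_diff: "bop_apply T (x - y) = bop_apply T x - bop_apply T y"
  by (rule bounded_clinear_diff_apply[OF bounded_clinear_bop_apply])

lemma bop_apply_sum: "bop_apply (\<Sum>i\<in>I. T i) x = (\<Sum>i\<in>I. bop_apply (T i) x)"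
  by (induction I rule: infinite_finite_induct) simp_all

lemma bop_apply_adj: "bop_apply (adj T) = cadjoint (bop_apply T)"
  unfolding adj_bop_def
  by (rule Bop_inverse) (simp add: bounded_clinear_cadjoint bounded_clinear_bop_apply)

lemma cinner_adj_left: "cinner (bop_apply (adj T) x) y = cinner x (bop_apply T y)"
  by (simp add: bop_apply_adj cinner_cadjoint_left bounded_clinear_bop_apply)

lemma cinner_adj_right: "cinner x (bop_apply (adj T) y) = cinner (bop_apply T x) y"
  by (simp add: bop_apply_adj cinner_cadjoint_right bounded_clinear_bop_apply)

lemma bop_eqI_cinner:
  assumes "\<And>x y. cinner x (bop_apply S y) = cinner x (bop_apply T y)"
  shows "S = T"
  by (intro bop_eqI cinner_ext assms)

lemma adj_bop_simps [simp]:
  fixes S T :: "'h::chilbert_space bop"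
  shows "adj (adj T) = T" "adj 0 = (0 :: 'h bop)" "adj 1 = (1 :: 'h bop)"
    "adj (S + T) = adj S + adj T" "adj (S * T) = adj T * adj S"
    "adj (S - T) = adj S - adj T"
  by (rule bop_eqI_cinner;
      simp add: cinner_adj_left cinner_adj_right cinner_add_left cinner_add_right
        cinner_diff_left cinner_diff_right)+

lemma sum_adj_mult_self_eq_0:
  fixes W :: "nat \<Rightarrow> 'h::chilbert_space bop"
  assumes "(\<Sum>k<n. adj (W k) * W k) = 0" and "k < n"
  shows "W k = 0"
proof (rule bop_eqI)
  fix x
  have "complex_of_real (\<Sum>k<n. (norm (bop_apply (W k) x))\<^sup>2) = cinner x (bop_apply (\<Sum>k<n. adj (W k) * W k) x)"
    by (simp add: bop_apply_sum cinner_sum_right cinner_adj_right cinner_self)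
  also have "\<dots> = 0"
    using assms(1) by simp
  finally have "(\<Sum>k<n. (norm (bop_apply (W k) x))\<^sup>2) = 0"
    using of_real_eq_0_iff by blast
  with assms(2) show "bop_apply (W k) x = bop_apply 0 x"
    by (simp add: sum_nonneg_eq_0_iff)
qed

section \<open>Positive operators and their resolvents\<close>

text \<open>Over the complex numbers an operator is determined by its quadratic form, by polarisation.\<close>

lemma op_le_antisym:
  assumes "op_le S T" and "op_le T S"
  shows "S = T"
proof (rule bop_eqI_cinner)
  define D where "D = T - S"
  have "cinner x (bop_apply D x) = 0" for x
  proof -
    have "cinner x (bop_apply (S - T) x) = - cinner x (bop_apply D x)"
      by (simp add: D_def cinner_diff_right)
    then show ?thesis
      using assms unfolding op_le_def D_def
      by (metis add.inverse_inverse complex_nonneg_Reals_iff complex_eq_iff neg_equal_0_iff_equal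
          neg_0_le_iff_le order_antisym uminus_complex.sel(1) zero_complex.sel)
  qed
  note D0 = this
  fix x y
  have "cinner x (bop_apply D y) + cinner y (bop_apply D x) = 0"
    using D0[of "x + y"] by (simp add: bop_apply_add cinner_add_left cinner_add_right D0 add.commute)
  moreover have "cinner x (bop_apply D y) - cinner y (bop_apply D x) = 0"
    using D0[of "x + \<i> *\<^sub>C y"]
    by (simp add: bop_apply_add bop_apply_scaleC cinner_add_left cinner_add_right
        cinner_scaleC_left cinner_scaleC_right D0)
  ultimately have "cinner x (bop_apply D y) = 0"
    by simp
  then show "cinner x (bop_apply S y) = cinner x (bop_apply T y)"
    by (simp add: D_def cinner_diff_right)
qed

lemma op_le_iff_Re:
  assumes "adj S = S" and "adj T = T"
  shows "op_le S T \<longleftrightarrow> (\<forall>x. Re (cinner x (bop_apply S x)) \<le> Re (cinner x (bop_apply T x)))"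
proof -
  have "Im (cinner x (bop_apply U x)) = 0" if "adj U = U" for U :: "'a bop" and x
  proof -
    have "cinner x (bop_apply U x) = cnj (cinner x (bop_apply U x))"
      using cinner_adj_left[of U x x] cinner_commute[of x "bop_apply U x"] that by simp
    then show ?thesis
      by (simp add: complex_eq_iff)
  qed
  then show ?thesis
    using assms by (simp add: op_le_def complex_nonneg_Reals_iff cinner_diff_right)
qed

definition positive_op :: "'h::chilbert_space bop \<Rightarrow> bool" where
  "positive_op a \<longleftrightarrow> adj a = a \<and> (\<forall>x. 0 \<le> Re (cinner x (bop_apply a x)))"

lemma positive_op_adj_mult: "positive_op (adj T * T)"
  by (simp add: positive_op_def cinner_adj_right cinner_self)

lemma positive_op_add: "positive_op a \<Longrightarrow> positive_op b \<Longrightarrow> positive_op (a + b)"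
  by (simp add: positive_op_def cinner_add_right)

lemma positive_op_scale:
  assumes "positive_op a" and "0 \<le> r"
  shows "positive_op (complex_of_real r *\<^sub>C a)"
proof -
  have "adj (complex_of_real r *\<^sub>C a) = complex_of_real r *\<^sub>C adj a"
    by (rule bop_eqI_cinner) (simp add: cinner_adj_left cinner_adj_right cinner_scaleC_left cinner_scaleC_right)
  then show ?thesis
    using assms by (simp add: positive_op_def cinner_scaleC_right)
qed

text \<open>The resolvent \<open>(a - z)\<^sup>-\<^sup>1\<close> at the point \<open>z = -1\<close>.\<close>

definition resolvent :: "'h::chilbert_space bop \<Rightarrow> 'h bop" where
  "resolvent a = Bop (inv (bop_apply (1 + a)))"

text \<open>The operator \<open>1 + a\<close> is bounded below by \<open>1\<close>, so it is injective with closed range, and a vector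
  orthogonal to the range is in its kernel because \<open>1 + a\<close> is self-adjoint.\<close>

lemma resolvent_inverse:
  fixes a :: "'h::chilbert_space bop"
  assumes "positive_op a"
  shows "(1 + a) * resolvent a = 1" and "resolvent a * (1 + a) = 1"
proof -
  define T where "T = 1 + a"
  have adjT: "adj T = T"
    using assms by (simp add: T_def positive_op_def)
  have below: "norm x \<le> norm (bop_apply T x)" for x
  proof -
    have "(norm x)\<^sup>2 \<le> Re (cinner x (bop_apply T x))"
      using assms by (simp add: T_def positive_op_def cinner_add_right norm_square_eq_Re_cinner)
    also have "\<dots> \<le> norm x * norm (bop_apply T x)"
      by (rule Re_cinner_le)
    finally show ?thesis
      by (cases "x = 0") (simp_all add: power2_eq_square)
  qed
  have inj: "inj (bop_apply T)"
  proof (rule injI)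
    fix x y
    assume "bop_apply T x = bop_apply T y"
    then show "x = y"
      using below[of "x - y"] by (simp add: bop_apply_diff)
  qed
  have "complete (bop_apply T ` UNIV)"
  proof (rule complete_isometric_image[where e = 1])
    show "bounded_linear (bop_apply T)"
      by (rule bounded_clinear_imp_bounded_linear[OF bounded_clinear_bop_apply])
  qed (use below in \<open>simp_all add: complete_UNIV\<close>)
  then have cl: "closed (range (bop_apply T))"
    by (rule complete_imp_closed)
  have sub: "complex_vector.subspace (range (bop_apply T))"
  proof (rule complex_vector.subspaceI)
    show "0 \<in> range (bop_apply T)"
      by (rule range_eqI[of _ _ 0]) simp
    show "x + y \<in> range (bop_apply T)" if xy: "x \<in> range (bop_apply T)" "y \<in> range (bop_apply T)" for x y
    proof -
      from xy obtain u v where "x = bop_apply T u" "y = bop_apply T v"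
        by (elim rangeE)
      then show ?thesis
        by (intro range_eqI[of _ _ "u + v"]) (simp only: bop_apply_add)
    qed
    show "c *\<^sub>C x \<in> range (bop_apply T)" if x: "x \<in> range (bop_apply T)" for c x
    proof -
      from x obtain u where "x = bop_apply T u"
        by (elim rangeE)
      then show ?thesis
        by (intro range_eqI[of _ _ "c *\<^sub>C u"]) (simp only: bop_apply_scaleC)
    qed
  qed
  have surj: "y \<in> range (bop_apply T)" for y
  proof -
    obtain m where m: "m \<in> range (bop_apply T)"
      and ortho: "\<And>z. z \<in> range (bop_apply T) \<Longrightarrow> cinner z (y - m) = 0"
      by (rule orthogonal_decomposition[OF sub cl, of y]) blast
    have "cinner z (bop_apply T (y - m)) = 0" for z
      using ortho[of "bop_apply T z"] cinner_adj_right[of z T "y - m"] adjT by simp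
    then have "bop_apply T (y - m) = 0"
      by (intro cinner_ext) simp
    then show ?thesis
      using below[of "y - m"] m by simp
  qed
  let ?R = "inv (bop_apply T)"
  have TR: "bop_apply T (?R x) = x" for x
    using surj by (rule f_inv_into_f)
  have RT: "?R (bop_apply T x) = x" for x
    using inj by (rule inv_f_f)
  have "?R (x + y) = ?R x + ?R y" for x y
    using RT[of "?R x + ?R y"] by (simp only: bop_apply_add TR)
  moreover have "?R (c *\<^sub>C x) = c *\<^sub>C ?R x" for c x
    using RT[of "c *\<^sub>C ?R x"] by (simp only: bop_apply_scaleC TR)
  moreover have "norm (?R x) \<le> 1 * norm x" for x
    using below[of "?R x"] by (simp add: TR)
  ultimately have "bounded_clinear ?R"
    unfolding bounded_clinear_def clinear_on_def by blast
  then have R: "bop_apply (resolvent a) = ?R"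
    unfolding resolvent_def T_def[symmetric] by (intro Bop_inverse) simp
  have "T * resolvent a = 1" "resolvent a * T = 1"
    by (rule bop_eqI; simp add: R TR RT)+
  then show "(1 + a) * resolvent a = 1" "resolvent a * (1 + a) = 1"
    by (simp_all add: T_def)
qed

lemma one_minus_resolvent:
  assumes "positive_op a"
  shows "1 - resolvent a = resolvent a * a" and "1 - resolvent a = a * resolvent a"
  using resolvent_inverse[OF assms] by (simp_all add: algebra_simps diff_eq_eq)

lemma adj_resolvent:
  assumes "positive_op a"
  shows "adj (resolvent a) = resolvent a"
proof -
  have "adj (resolvent a) * (1 + a) = 1"
    using arg_cong[OF resolvent_inverse(1)[OF assms], of adj] assms by (simp add: positive_op_def)
  then show ?thesis
    by (metis assms mult.assoc mult_1_left mult_1_right resolvent_inverse(1))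
qed

text \<open>Together with the bicommutant property this keeps resolvents inside the von Neumann algebra.\<close>

lemma resolvent_commute:
  assumes "positive_op a" and "S * a = a * S"
  shows "S * resolvent a = resolvent a * S"
proof -
  have "S * resolvent a = resolvent a * ((1 + a) * S) * resolvent a"
    using resolvent_inverse(2)[OF assms(1)] by (simp add: mult.assoc[symmetric])
  also have "(1 + a) * S = S * (1 + a)"
    using assms(2) by (simp add: algebra_simps)
  also have "resolvent a * (S * (1 + a)) * resolvent a = resolvent a * S"
    using resolvent_inverse(1)[OF assms(1)] by (simp add: mult.assoc)
  finally show ?thesis .
qed

lemma resolvent_solves:
  assumes "positive_op a"
  shows "bop_apply (resolvent a) x + bop_apply a (bop_apply (resolvent a) x) = x"
  using arg_cong[OF resolvent_inverse(1)[OF assms], of "\<lambda>T. bop_apply T x"] by simp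

text \<open>With \<open>u = resolvent a x\<close> one has \<open>x = u + a u\<close>, and \<open>a\<close> contributes a nonnegative term.\<close>

lemma norm_resolvent_square_le:
  assumes "positive_op a"
  shows "(norm (bop_apply (resolvent a) x))\<^sup>2 \<le> Re (cinner x (bop_apply (resolvent a) x))"
proof -
  let ?u = "bop_apply (resolvent a) x"
  have "Re (cinner x ?u) = Re (cinner (?u + bop_apply a ?u) ?u)"
    by (simp add: resolvent_solves[OF assms])
  also have "\<dots> = (norm ?u)\<^sup>2 + Re (cinner ?u (bop_apply a ?u))"
    by (simp add: cinner_add_left norm_square_eq_Re_cinner Re_cinner_commute[of "bop_apply a ?u"])
  finally show ?thesis
    using assms by (simp add: positive_op_def)
qed

lemma norm_resolvent_le:
  assumes "positive_op a"
  shows "norm (bop_apply (resolvent a) x) \<le> norm x"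
proof -
  have "(norm (bop_apply (resolvent a) x))\<^sup>2 \<le> norm x * norm (bop_apply (resolvent a) x)"
    using norm_resolvent_square_le[OF assms] Re_cinner_le order_trans by blast
  then show ?thesis
    by (cases "bop_apply (resolvent a) x = 0") (simp_all add: power2_eq_square)
qed

text \<open>Expand \<open>0 \<le> \<langle>u - v, (1 + a) (u - v)\<rangle>\<close> for \<open>u = resolvent a x\<close> and \<open>v = resolvent b x\<close>, and bound
  \<open>\<langle>v, (1 + a) v\<rangle>\<close> by \<open>\<langle>v, (1 + b) v\<rangle> = \<langle>v, x\<rangle>\<close>.\<close>

lemma resolvent_antimono:
  assumes a: "positive_op a" and b: "positive_op b"
    and le: "\<And>x. Re (cinner x (bop_apply a x)) \<le> Re (cinner x (bop_apply b x))"
  shows "Re (cinner x (bop_apply (resolvent b) x)) \<le> Re (cinner x (bop_apply (resolvent a) x))"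
proof -
  define u where "u = bop_apply (resolvent a) x"
  define v where "v = bop_apply (resolvent b) x"
  have u: "bop_apply a u = x - u" and v: "bop_apply b v = x - v"
    using resolvent_solves[OF a, of x] resolvent_solves[OF b, of x]
    by (simp_all add: u_def v_def algebra_simps)
  have sym: "cinner u (bop_apply a v) = cinner (x - u) v"
    using cinner_adj_left[of a u v] a u by (simp add: positive_op_def)
  have "0 \<le> Re (cinner (u - v) (bop_apply (1 + a) (u - v)))"
    using a by (simp add: positive_op_def cinner_add_right cinner_self)
  also have "\<dots> = Re (cinner u x) - Re (cinner x v) - Re (cinner v x) + (Re (cinner v v) + Re (cinner v (bop_apply a v)))"
    by (simp add: bop_apply_diff u cinner_diff_left cinner_diff_right cinner_add_right sym)
  also have "\<dots> \<le> Re (cinner u x) - Re (cinner x v) - Re (cinner v x) + (Re (cinner v v) + Re (cinner v (bop_apply b v)))"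
    using le[of v] by simp
  also have "\<dots> = Re (cinner x u) - Re (cinner x v)"
    using Re_cinner_commute[of u x] Re_cinner_commute[of v x] by (simp add: v cinner_diff_right)
  finally show ?thesis
    by (simp add: u_def v_def)
qed

text \<open>With \<open>u\<close> the vector on the left and \<open>w = y - r u\<close> one has \<open>u = a w\<close>, so \<open>0 \<le> \<langle>w, u\<rangle>\<close>, which says
  \<open>r \<parallel>u\<parallel>\<^sup>2 \<le> \<langle>y, u\<rangle>\<close>.\<close>

lemma norm_resolvent_scaled_range:
  assumes a: "positive_op a" and "0 < r"
  shows "norm (bop_apply (resolvent (complex_of_real r *\<^sub>C a)) (bop_apply a y)) \<le> norm y / r"
proof -
  define u where "u = bop_apply (resolvent (complex_of_real r *\<^sub>C a)) (bop_apply a y)"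
  define w where "w = y - complex_of_real r *\<^sub>C u"
  have "u + complex_of_real r *\<^sub>C bop_apply a u = bop_apply a y"
    using resolvent_solves[OF positive_op_scale[OF a], of r] \<open>0 < r\<close> by (simp add: u_def)
  then have "bop_apply a w = u"
    unfolding w_def bop_apply_diff bop_apply_scaleC by (metis add_diff_cancel_right')
  then have "0 \<le> Re (cinner w u)"
    using a by (metis positive_op_def)
  also have "\<dots> = Re (cinner y u) - r * (norm u)\<^sup>2"
    by (simp add: w_def cinner_diff_left cinner_scaleC_left norm_square_eq_Re_cinner)
  finally have "(r * norm u) * norm u \<le> norm y * norm u"
    using Re_cinner_le[of y u] by (simp add: power2_eq_square)
  then have "r * norm u \<le> norm y"
    using \<open>0 < r\<close> by (cases "u = 0") simp_all
  then show ?thesis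
    using \<open>0 < r\<close> by (simp add: u_def field_simps)
qed

section \<open>Orthogonal projections\<close>

definition projection_onto :: "'h::chilbert_space set \<Rightarrow> 'h bop \<Rightarrow> bool" where
  "projection_onto M Q \<longleftrightarrow>
     (\<forall>x. bop_apply Q x \<in> M) \<and> (\<forall>x. \<forall>y\<in>M. cinner y (x - bop_apply Q x) = 0)"

lemma orthogonal_component_unique:
  assumes M: "complex_vector.subspace M" and "m \<in> M" "m' \<in> M"
    and "\<And>y. y \<in> M \<Longrightarrow> cinner y (x - m) = 0" and "\<And>y. y \<in> M \<Longrightarrow> cinner y (x - m') = 0"
  shows "m = m'"
proof -
  have "m - m' \<in> M"
    using assms by (simp add: complex_vector.subspace_diff)
  then have "cinner (m - m') (x - m') - cinner (m - m') (x - m) = 0"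
    using assms(4,5) by simp
  then show ?thesis
    by (simp add: cinner_diff_right[symmetric] cinner_self)
qed

lemma projection_onto_exists:
  fixes M :: "'h::chilbert_space set"
  assumes M: "complex_vector.subspace M" and "closed M"
  obtains Q where "projection_onto M Q"
proof -
  have "\<forall>x. \<exists>m. m \<in> M \<and> (\<forall>y\<in>M. cinner y (x - m) = 0)"
    by (intro allI, rule orthogonal_decomposition[OF assms]) blast
  from choice[OF this] obtain p
    where pM: "\<And>x. p x \<in> M" and ortho: "\<And>x y. y \<in> M \<Longrightarrow> cinner y (x - p x) = 0"
    by blast
  have "p (x + y) = p x + p y" for x y
  proof (rule orthogonal_component_unique[OF M pM])
    show "p x + p y \<in> M"
      by (simp add: M pM complex_vector.subspace_add)
    show "cinner z (x + y - (p x + p y)) = 0" if "z \<in> M" for z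
      using ortho[OF that, of x] ortho[OF that, of y]
      by (simp add: cinner_diff_right cinner_add_right)
  qed (rule ortho)
  moreover have "p (c *\<^sub>C x) = c *\<^sub>C p x" for c x
  proof (rule orthogonal_component_unique[OF M pM])
    show "c *\<^sub>C p x \<in> M"
      by (simp add: M pM complex_vector.subspace_scale)
    show "cinner z (c *\<^sub>C x - c *\<^sub>C p x) = 0" if "z \<in> M" for z
      using ortho[OF that, of x]
      by (simp add: cinner_diff_right cinner_scaleC_right)
  qed (rule ortho)
  moreover have "norm (p x) \<le> 1 * norm x" for x
  proof -
    have "cinner (p x) x = cinner (p x) (p x)"
      using ortho[OF pM[of x], of x] by (simp add: cinner_diff_right)
    then have "(norm (p x))\<^sup>2 \<le> norm (p x) * norm x"
      using Re_cinner_le[of "p x" x] by (simp add: norm_square_eq_Re_cinner)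
    then show ?thesis
      by (cases "p x = 0") (simp_all add: power2_eq_square)
  qed
  ultimately have "bounded_clinear p"
    unfolding bounded_clinear_def clinear_on_def by blast
  then have "bop_apply (Bop p) = p"
    by (intro Bop_inverse) simp
  then have "projection_onto M (Bop p)"
    using pM ortho by (simp add: projection_onto_def)
  then show thesis
    by (rule that)
qed

context
  fixes M :: "'h::chilbert_space set" and Q
  assumes M: "complex_vector.subspace M" and Q: "projection_onto M Q"
begin

lemma projection_onto_eqI:
  assumes "m \<in> M" and "\<And>y. y \<in> M \<Longrightarrow> cinner y (x - m) = 0"
  shows "bop_apply Q x = m"
  by (rule orthogonal_component_unique[OF M])
    (use assms Q in \<open>auto simp: projection_onto_def\<close>)

lemma projection_onto_apply_self: "x \<in> M \<Longrightarrow> bop_apply Q x = x"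
  by (rule projection_onto_eqI) simp_all

lemma cinner_projection_onto: "cinner (bop_apply Q x) y = cinner (bop_apply Q x) (bop_apply Q y)"
proof -
  have "cinner (bop_apply Q x) (y - bop_apply Q y) = 0"
    using Q by (auto simp: projection_onto_def)
  then show ?thesis
    by (simp add: cinner_diff_right)
qed

lemma adj_projection_onto: "adj Q = Q"
proof (rule bop_eqI_cinner)
  fix x y
  have "cinner x (bop_apply Q y) = cinner (bop_apply Q x) (bop_apply Q y)"
    using cinner_projection_onto[of y x] cinner_commute[of x "bop_apply Q y"]
      cinner_commute[of "bop_apply Q x" "bop_apply Q y"] by simp
  then show "cinner x (bop_apply (adj Q) y) = cinner x (bop_apply Q y)"
    using cinner_projection_onto[of x y] by (simp add: cinner_adj_right)
qed

lemma projection_onto_idem: "Q * Q = Q"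
  by (rule bop_eqI) (use Q in \<open>simp add: projection_onto_def projection_onto_apply_self\<close>)

lemma Re_cinner_projection_onto: "Re (cinner x (bop_apply Q x)) = (norm (bop_apply Q x))\<^sup>2"
  using cinner_projection_onto[of x x] Re_cinner_commute[of x "bop_apply Q x"]
  by (simp add: norm_square_eq_Re_cinner)

lemma projection_onto_commute:
  assumes "\<And>x. x \<in> M \<Longrightarrow> bop_apply S x \<in> M" and "\<And>x. x \<in> M \<Longrightarrow> bop_apply (adj S) x \<in> M"
  shows "Q * S = S * Q"
proof (rule bop_eqI)
  fix x
  have "bop_apply Q (bop_apply S x) = bop_apply S (bop_apply Q x)"
  proof (rule projection_onto_eqI)
    show "bop_apply S (bop_apply Q x) \<in> M"
      using assms(1) Q by (simp add: projection_onto_def)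
    fix y
    assume "y \<in> M"
    then have "cinner (bop_apply (adj S) y) (x - bop_apply Q x) = 0"
      using assms(2) Q by (simp add: projection_onto_def)
    then show "cinner y (bop_apply S x - bop_apply S (bop_apply Q x)) = 0"
      by (simp add: cinner_adj_left bop_apply_diff)
  qed
  then show "bop_apply (Q * S) x = bop_apply (S * Q) x"
    by simp
qed

end

section \<open>Completely positive maps and their null ideals\<close>

text \<open>The Gram matrix \<open>(X\<^sub>i\<^sup>* X\<^sub>j)\<close> is positive: it is \<open>Y\<^sup>* Y\<close> for the square matrix \<open>Y\<close> whose row
  \<open>0\<close> is \<open>(X\<^sub>0, \<dots>, X\<^sub>n\<^sub>-\<^sub>1)\<close> and whose other rows are zero. The resulting \<open>W\<close> is a finite piece of
  the Stinespring dilation of \<open>\<phi>\<close>: column \<open>i\<close> applied to \<open>h\<close> stands for the vector \<open>X\<^sub>i \<otimes> h\<close>.\<close>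

lemma completely_positive_gram:
  fixes X :: "nat \<Rightarrow> 'a::{complex_vector, ring, adjoint}"
    and \<phi> :: "'a \<Rightarrow> 'b::{complex_vector, times, adjoint}"
  assumes cp: "completely_positive M N \<phi>" and "0 \<in> M" and adj0: "adj (0::'a) = 0"
    and X: "\<And>i. i < n \<Longrightarrow> X i \<in> M"
  obtains W where "\<And>i j. i < n \<Longrightarrow> j < n \<Longrightarrow> W i j \<in> N"
    and "\<And>i j. i < n \<Longrightarrow> j < n \<Longrightarrow> \<phi> (adj (X i) * X j) = (\<Sum>k<n. adj (W k i) * W k j)"
proof -
  have "positive_matrix M n (\<lambda>i j. adj (X i) * X j)"
    unfolding positive_matrix_def
  proof (intro exI[of _ "\<lambda>k i. if k = 0 then X i else 0"] conjI allI impI)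
    fix i j
    assume "i < n" "j < n"
    then show "(if i = 0 then X j else 0) \<in> M"
      using X \<open>0 \<in> M\<close> by simp
    have "(\<Sum>k<n. adj (if k = 0 then X i else 0) * (if k = 0 then X j else 0))
        = (\<Sum>k<n. if k = 0 then adj (X i) * X j else 0)"
      by (intro sum.cong) (auto simp: adj0)
    also have "\<dots> = adj (X i) * X j"
      using \<open>i < n\<close> by simp
    finally show "adj (X i) * X j
        = (\<Sum>k<n. adj (if k = 0 then X i else 0) * (if k = 0 then X j else 0))"
      by (rule sym)
  qed
  then have "positive_matrix N n (\<lambda>i j. \<phi> (adj (X i) * X j))"
    using cp unfolding completely_positive_def by blast
  then show thesis
    unfolding positive_matrix_def using that by blast
qed

lemma unital_star_subalgebraD:
  fixes B :: "'h::chilbert_space bop set"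
  assumes "unital_star_subalgebra B"
  shows "1 \<in> B" and "0 \<in> B" and "S \<in> B \<Longrightarrow> T \<in> B \<Longrightarrow> S + T \<in> B"
    and "S \<in> B \<Longrightarrow> T \<in> B \<Longrightarrow> S * T \<in> B" and "S \<in> B \<Longrightarrow> T \<in> B \<Longrightarrow> S - T \<in> B"
    and "T \<in> B \<Longrightarrow> c *\<^sub>C T \<in> B" and "T \<in> B \<Longrightarrow> adj T \<in> B"
proof -
  show closed: "1 \<in> B" "S \<in> B \<Longrightarrow> T \<in> B \<Longrightarrow> S + T \<in> B" "S \<in> B \<Longrightarrow> T \<in> B \<Longrightarrow> S * T \<in> B"
    "T \<in> B \<Longrightarrow> c *\<^sub>C T \<in> B" "T \<in> B \<Longrightarrow> adj T \<in> B" for S T c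
    using assms by (simp_all add: unital_star_subalgebra_def)
  show "0 \<in> B"
    using closed(4)[OF closed(1), of 0] by simp
  show "S \<in> B \<Longrightarrow> T \<in> B \<Longrightarrow> S - T \<in> B"
    using closed(2)[OF _ closed(4), of S T "-1"] by simp
qed

locale cp_on_star_algebra =
  fixes B :: "'h::chilbert_space bop set" and C :: "'g::chilbert_space bop set"
    and \<xi> :: "'h bop \<Rightarrow> 'g bop"
  assumes star: "unital_star_subalgebra B" and cp: "completely_positive B C \<xi>"
begin

lemmas star_closed = unital_star_subalgebraD[OF star]

lemma map_add: "X \<in> B \<Longrightarrow> Y \<in> B \<Longrightarrow> \<xi> (X + Y) = \<xi> X + \<xi> Y"
  using cp by (auto simp: completely_positive_def clinear_on_def)

text \<open>In the Gram factorisation of \<open>\<xi>\<close> on the pair \<open>Y\<^sup>*\<close>, \<open>X\<close>, the column belonging to \<open>X\<close> vanishes,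
  because its entries satisfy \<open>(\<Sum>k. W\<^sub>k\<^sup>* W\<^sub>k) = \<xi> (X\<^sup>* X) = 0\<close>.\<close>

lemma map_mult_null:
  assumes X: "X \<in> null_ideal B \<xi>" and Y: "Y \<in> B"
  shows "\<xi> (Y * X) = 0"
proof -
  have XB: "X \<in> B" and X0: "\<xi> (adj X * X) = 0"
    using X by (simp_all add: null_ideal_def)
  define Z where "Z i = (if i = 0 then adj Y else X)" for i :: nat
  have ZB: "Z i \<in> B" for i
    using XB star_closed(7)[OF Y] by (simp add: Z_def)
  obtain W where W: "\<And>i j. i < 2 \<Longrightarrow> j < 2 \<Longrightarrow> \<xi> (adj (Z i) * Z j) = (\<Sum>k<2::nat. adj (W k i) * W k j)"
    by (rule completely_positive_gram[OF cp star_closed(2), of 2 Z]) (use ZB in auto)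
  have W0: "W k 1 = 0" if "k < 2" for k
    by (rule sum_adj_mult_self_eq_0[where W = "\<lambda>k. W k 1" and n = 2, OF _ that])
      (use W[of 1 1] X0 in \<open>simp add: Z_def\<close>)
  show ?thesis
    using W[of 0 1] W0 by (simp add: Z_def)
qed

lemma null_ideal_subset: "X \<in> null_ideal B \<xi> \<Longrightarrow> X \<in> B"
  by (simp add: null_ideal_def)

lemma null_ideal_mult:
  assumes X: "X \<in> null_ideal B \<xi>" and Y: "Y \<in> B"
  shows "Y * X \<in> null_ideal B \<xi>"
  using map_mult_null[OF X, of "adj X * adj Y * Y"] null_ideal_subset[OF X] Y
  by (simp add: null_ideal_def star_closed mult.assoc)

lemma null_ideal_add:
  assumes X: "X \<in> null_ideal B \<xi>" and Y: "Y \<in> null_ideal B \<xi>"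
  shows "X + Y \<in> null_ideal B \<xi>"
proof -
  have XB: "X \<in> B" and YB: "Y \<in> B"
    using X Y by (simp_all add: null_ideal_subset)
  have "adj (X + Y) * (X + Y) = adj (X + Y) * X + adj (X + Y) * Y"
    by (rule distrib_left)
  then have "\<xi> (adj (X + Y) * (X + Y)) = 0"
    using XB YB map_mult_null[OF X, of "adj (X + Y)"] map_mult_null[OF Y, of "adj (X + Y)"]
    by (simp add: map_add star_closed)
  then show ?thesis
    using XB YB by (simp add: null_ideal_def star_closed)
qed

lemma null_ideal_scale:
  assumes X: "X \<in> null_ideal B \<xi>"
  shows "c *\<^sub>C X \<in> null_ideal B \<xi>"
proof -
  have "c *\<^sub>C X = (c *\<^sub>C 1) * X"
    by (rule bop_eqI) simp
  then show ?thesis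
    using null_ideal_mult[OF X, of "c *\<^sub>C 1"] by (simp add: star_closed)
qed

lemma null_ideal_zero: "0 \<in> null_ideal B \<xi>"
  using map_add[of 0 0] by (simp add: null_ideal_def star_closed)

text \<open>These elements index the net \<open>1 - resolvent a\<close>. Positivity is that of the quadratic form, so
  that no square root of \<open>a\<close> is involved.\<close>

definition positive_null :: "'h bop set" where
  "positive_null = {a \<in> null_ideal B \<xi>. positive_op a}"

lemma positive_nullD: "a \<in> positive_null \<Longrightarrow> a \<in> null_ideal B \<xi>" "a \<in> positive_null \<Longrightarrow> positive_op a"
  by (simp_all add: positive_null_def)

lemma positive_null_zero: "0 \<in> positive_null"
  using null_ideal_zero by (simp add: positive_null_def positive_op_def)

lemma positive_null_add: "a \<in> positive_null \<Longrightarrow> b \<in> positive_null \<Longrightarrow> a + b \<in> positive_null"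
  by (simp add: positive_null_def positive_op_add null_ideal_add)

lemma positive_null_scale: "a \<in> positive_null \<Longrightarrow> 0 \<le> r \<Longrightarrow> complex_of_real r *\<^sub>C a \<in> positive_null"
  by (simp add: positive_null_def positive_op_scale null_ideal_scale)

lemma positive_null_adj_mult: "X \<in> null_ideal B \<xi> \<Longrightarrow> adj X * X \<in> positive_null"
  by (simp add: positive_null_def positive_op_adj_mult null_ideal_mult null_ideal_subset star_closed)

lemma resolvent_sum_le:
  assumes "a \<in> positive_null" and "b \<in> positive_null"
  shows "Re (cinner x (bop_apply (resolvent (a + b)) x)) \<le> Re (cinner x (bop_apply (resolvent a) x))"
  using positive_nullD(2)[OF assms(1)] positive_nullD(2)[OF assms(2)]
  by (intro resolvent_antimono positive_op_add) (simp_all add: cinner_add_right positive_op_def)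

text \<open>The closed span of the ranges of the operators in \<open>positive_null\<close>. Unlike the span itself, this
  description is visibly closed and passes to sums because \<open>positive_null\<close> is directed.\<close>

definition null_range :: "'h set" where
  "null_range = {x. \<forall>e>0. \<exists>a\<in>positive_null. norm (bop_apply (resolvent a) x) < e}"

text \<open>For the quadratic form \<open>\<langle>x, resolvent a x\<rangle>\<close> smallness persists along the net by monotonicity; for
  the norm it then follows because norm and form bound each other:
  \<open>\<parallel>resolvent a x\<parallel>\<^sup>2 \<le> \<langle>x, resolvent a x\<rangle> \<le> \<parallel>x\<parallel> \<parallel>resolvent a x\<parallel>\<close>.\<close>

lemma null_range_tail:
  assumes "x \<in> null_range" and "e > 0"
  obtains a where "a \<in> positive_null"
    and "\<And>b. b \<in> positive_null \<Longrightarrow> norm (bop_apply (resolvent (a + b)) x) < e"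
proof -
  have "e\<^sup>2 / (norm x + 1) > 0"
    using \<open>e > 0\<close> by (simp add: add_nonneg_pos)
  then obtain a where a: "a \<in> positive_null"
    and small: "norm (bop_apply (resolvent a) x) < e\<^sup>2 / (norm x + 1)"
    using assms(1) unfolding null_range_def by blast
  have "norm (bop_apply (resolvent (a + b)) x) < e" if b: "b \<in> positive_null" for b
  proof -
    have "(norm (bop_apply (resolvent (a + b)) x))\<^sup>2 \<le> Re (cinner x (bop_apply (resolvent (a + b)) x))"
      using a b by (intro norm_resolvent_square_le positive_nullD positive_null_add)
    also have "\<dots> \<le> Re (cinner x (bop_apply (resolvent a) x))"
      using a b by (rule resolvent_sum_le)
    also have "\<dots> \<le> norm x * norm (bop_apply (resolvent a) x)"
      by (rule Re_cinner_le)
    also have "\<dots> \<le> norm x * (e\<^sup>2 / (norm x + 1))"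
      using small by (intro mult_left_mono) simp_all
    also have "\<dots> < e\<^sup>2"
      using \<open>e > 0\<close> by (simp add: add_pos_nonneg pos_divide_less_eq add.commute[of _ 1] distrib_right)
    finally show ?thesis
      using \<open>e > 0\<close> by (simp add: power2_less_imp_less)
  qed
  with a show thesis
    by (rule that)
qed

lemma subspace_null_range: "complex_vector.subspace null_range"
proof (rule complex_vector.subspaceI)
  show "0 \<in> null_range"
    using positive_null_zero by (auto simp: null_range_def)
next
  fix x y
  assume x: "x \<in> null_range" and y: "y \<in> null_range"
  show "x + y \<in> null_range"
    unfolding null_range_def mem_Collect_eq
  proof (intro allI impI)
    fix e :: real
    assume "e > 0"
    then have e2: "e / 2 > 0" by simp
    obtain a where a: "a \<in> positive_null"
      and xa: "\<And>b. b \<in> positive_null \<Longrightarrow> norm (bop_apply (resolvent (a + b)) x) < e / 2"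
      by (rule null_range_tail[OF x e2]) blast
    obtain b where b: "b \<in> positive_null"
      and yb: "\<And>a. a \<in> positive_null \<Longrightarrow> norm (bop_apply (resolvent (b + a)) y) < e / 2"
      by (rule null_range_tail[OF y e2]) blast
    have "norm (bop_apply (resolvent (a + b)) (x + y)) < e"
      using xa[OF b] yb[OF a]
        norm_triangle_ineq[of "bop_apply (resolvent (a + b)) x" "bop_apply (resolvent (a + b)) y"]
      by (simp add: bop_apply_add add.commute[of b a])
    then show "\<exists>a\<in>positive_null. norm (bop_apply (resolvent a) (x + y)) < e"
      using positive_null_add[OF a b] by blast
  qed
next
  fix c x
  assume x: "x \<in> null_range"
  show "c *\<^sub>C x \<in> null_range"
    unfolding null_range_def mem_Collect_eq
  proof (intro allI impI)
    fix e :: real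
    assume "e > 0"
    then have "e / (cmod c + 1) > 0"
      by (simp add: add_nonneg_pos)
    then obtain a where a: "a \<in> positive_null"
      and small: "norm (bop_apply (resolvent a) x) < e / (cmod c + 1)"
      using x unfolding null_range_def by blast
    have "norm (bop_apply (resolvent a) (c *\<^sub>C x)) \<le> (cmod c + 1) * norm (bop_apply (resolvent a) x)"
      by (simp add: bop_apply_scaleC norm_scaleC mult_right_mono)
    also have "\<dots> < e"
      using small by (simp add: less_divide_eq add_nonneg_pos mult.commute)
    finally show "\<exists>a\<in>positive_null. norm (bop_apply (resolvent a) (c *\<^sub>C x)) < e"
      using a by blast
  qed
qed

lemma closed_null_range: "closed null_range"
proof -
  have "x \<in> null_range" if x: "x \<in> closure null_range" for x
    unfolding null_range_def mem_Collect_eq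
  proof (intro allI impI)
    fix e :: real
    assume "e > 0"
    then have "e / 2 > 0" by simp
    then obtain y where "y \<in> null_range" and "dist y x < e / 2"
      using x unfolding closure_approachable by blast
    obtain a where a: "a \<in> positive_null" and small: "norm (bop_apply (resolvent a) y) < e / 2"
      using \<open>y \<in> null_range\<close> \<open>e / 2 > 0\<close> unfolding null_range_def by blast
    have "bop_apply (resolvent a) x = bop_apply (resolvent a) y + bop_apply (resolvent a) (x - y)"
      by (simp add: bop_apply_diff)
    moreover have "norm (bop_apply (resolvent a) (x - y)) \<le> dist y x"
      using norm_resolvent_le[OF positive_nullD(2)[OF a], of "x - y"]
      by (simp add: dist_norm norm_minus_commute)
    ultimately have "norm (bop_apply (resolvent a) x) < e"
      using small \<open>dist y x < e / 2\<close>
        norm_triangle_ineq[of "bop_apply (resolvent a) y" "bop_apply (resolvent a) (x - y)"]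
      by simp
    with a show "\<exists>a\<in>positive_null. norm (bop_apply (resolvent a) x) < e"
      by blast
  qed
  then show ?thesis
    using closure_subset_eq by blast
qed

text \<open>Large multiples of \<open>a\<close> are again indices of the net, and their resolvents are small on the range
  of \<open>a\<close>.\<close>

lemma range_positive_null:
  assumes "a \<in> positive_null"
  shows "bop_apply a y \<in> null_range"
  unfolding null_range_def mem_Collect_eq
proof (intro allI impI)
  fix e :: real
  assume "e > 0"
  define r where "r = (norm y + 1) / e"
  have "r > 0"
    using \<open>e > 0\<close> by (simp add: r_def add_nonneg_pos)
  have "norm (bop_apply (resolvent (complex_of_real r *\<^sub>C a)) (bop_apply a y)) \<le> norm y / r"
    by (rule norm_resolvent_scaled_range[OF positive_nullD(2)[OF assms] \<open>r > 0\<close>])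
  also have "\<dots> < e"
    using \<open>e > 0\<close> \<open>r > 0\<close> by (simp add: divide_less_eq) (simp add: r_def)
  finally show "\<exists>b\<in>positive_null. norm (bop_apply (resolvent b) (bop_apply a y)) < e"
    using positive_null_scale[OF assms, of r] \<open>r > 0\<close> by (meson less_imp_le)
qed

end

section \<open>The support projection of a normal map\<close>

locale normal_cp_on_von_neumann_algebra = cp_on_star_algebra +
  assumes bicommutant: "commutant (commutant B) = B"
    and starC: "unital_star_subalgebra C"
    and normal: "normal_map B C \<xi>"
begin

lemma resolvent_in:
  assumes "a \<in> B" and "positive_op a"
  shows "resolvent a \<in> B"
proof -
  have "resolvent a * S = S * resolvent a" if "S \<in> commutant B" for S
    using resolvent_commute[OF assms(2), of S] that assms(1) by (simp add: commutant_def)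
  then have "resolvent a \<in> commutant (commutant B)"
    by (simp add: commutant_def)
  then show ?thesis
    by (simp add: bicommutant)
qed

lemma commutant_adj:
  assumes "S \<in> commutant B"
  shows "adj S \<in> commutant B"
proof -
  have "adj S * T = T * adj S" if "T \<in> B" for T
  proof -
    have "S * adj T = adj T * S"
      using assms star_closed(7)[OF that] by (simp add: commutant_def)
    from arg_cong[OF this, of adj] show ?thesis
      by simp
  qed
  then show ?thesis
    by (simp add: commutant_def)
qed

lemma commutant_null_range:
  assumes S: "S \<in> commutant B" and x: "x \<in> null_range"
  shows "bop_apply S x \<in> null_range"
  unfolding null_range_def mem_Collect_eq
proof (intro allI impI)
  fix e :: real
  assume "e > 0"
  obtain K where "K > 0" and K: "\<And>x. norm (bop_apply S x) \<le> K * norm x"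
    by (rule bounded_clinear_pos_bound[OF bounded_clinear_bop_apply[of S]]) blast
  have "e / K > 0"
    using \<open>e > 0\<close> \<open>K > 0\<close> by simp
  then obtain a where a: "a \<in> positive_null" and small: "norm (bop_apply (resolvent a) x) < e / K"
    using x unfolding null_range_def by blast
  have "S * resolvent a = resolvent a * S"
    using S resolvent_in[OF null_ideal_subset positive_nullD(2)] a positive_nullD(1)
    by (simp add: commutant_def)
  from arg_cong[OF this, of "\<lambda>T. bop_apply T x"]
  have "norm (bop_apply (resolvent a) (bop_apply S x)) \<le> K * norm (bop_apply (resolvent a) x)"
    using K[of "bop_apply (resolvent a) x"] by simp
  also have "\<dots> < e"
    using small \<open>K > 0\<close> by (simp add: less_divide_eq mult.commute)
  finally show "\<exists>a\<in>positive_null. norm (bop_apply (resolvent a) (bop_apply S x)) < e"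
    using a by blast
qed

text \<open>\<open>Q\<close> is the orthogonal projection onto \<open>null_range\<close>. It lies in \<open>B\<close> because the commutant leaves
  \<open>null_range\<close> invariant, and it is the supremum of the net since \<open>\<langle>x, (1 - resolvent a) x\<rangle>\<close> differs from
  \<open>\<parallel>Q x\<parallel>\<^sup>2\<close> by a term that tends to zero. For \<open>X\<close> in the null ideal, \<open>X\<^sup>* X\<close> is an index of the net, so
  its range lies in \<open>null_range\<close>; being self-adjoint, it vanishes on the orthogonal complement, and
  with it \<open>X\<close>.\<close>

lemma support_projection_exists:
  obtains Q where "Q \<in> null_ideal B \<xi>" and "\<And>X. X \<in> null_ideal B \<xi> \<Longrightarrow> X * Q = X"
proof -
  obtain Q where Q: "projection_onto null_range Q"
    by (rule projection_onto_exists[OF subspace_null_range closed_null_range])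
  note proj = subspace_null_range Q
  have adjQ: "adj Q = Q" and QQ: "Q * Q = Q"
    by (rule adj_projection_onto[OF proj], rule projection_onto_idem[OF proj])
  have "Q * S = S * Q" if "S \<in> commutant B" for S
    using that by (intro projection_onto_commute[OF proj] commutant_null_range commutant_adj)
  then have "Q \<in> commutant (commutant B)"
    by (simp add: commutant_def)
  then have QB: "Q \<in> B"
    by (simp add: bicommutant)

  define D where "D = (\<lambda>a. 1 - resolvent a) ` positive_null"
  have adjT: "adj (1 - resolvent a) = 1 - resolvent a" if "a \<in> positive_null" for a
    using positive_nullD(2)[OF that] by (simp add: adj_resolvent)
  \<comment> \<open>The range of \<open>1 - resolvent a = a * resolvent a\<close> lies in \<open>null_range\<close>, so the operator is
    compressed to \<open>null_range\<close> by \<open>Q\<close> without change.\<close>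
  have form: "Re (cinner x (bop_apply (1 - resolvent a) x))
      = (norm (bop_apply Q x))\<^sup>2 - Re (cinner (bop_apply Q x) (bop_apply (resolvent a) (bop_apply Q x)))"
    if a: "a \<in> positive_null" for a x
  proof -
    let ?T = "1 - resolvent a"
    have QT: "Q * ?T = ?T"
      unfolding one_minus_resolvent(2)[OF positive_nullD(2)[OF a]]
      by (rule bop_eqI) (simp add: projection_onto_apply_self[OF proj] range_positive_null[OF a])
    from arg_cong[OF this, of adj] have TQ: "?T * Q = ?T"
      by (simp only: adj_bop_simps(5) adjQ adjT[OF a])
    have "bop_apply ?T x = bop_apply Q (bop_apply ?T (bop_apply Q x))"
      by (metis QT TQ bop_apply_simps(5))
    then have "cinner x (bop_apply ?T x) = cinner (bop_apply Q x) (bop_apply ?T (bop_apply Q x))"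
      using cinner_adj_right[of x Q] adjQ by simp
    then show ?thesis
      by (simp add: cinner_diff_right norm_square_eq_Re_cinner)
  qed
  have "op_lub B D Q"
    unfolding op_lub_def
  proof (intro conjI ballI impI)
    show "Q \<in> self_adjoint_part B"
      using QB adjQ by (simp add: self_adjoint_part_def)
  next
    fix T
    assume "T \<in> D"
    then obtain a where a: "a \<in> positive_null" and T: "T = 1 - resolvent a"
      by (auto simp: D_def)
    have "0 \<le> Re (cinner y (bop_apply (resolvent a) y))" for y
      using norm_resolvent_square_le[OF positive_nullD(2)[OF a], of y] zero_le_power2 order_trans by blast
    then show "op_le T Q"
      using form[OF a]
      by (subst op_le_iff_Re) (simp_all only: T adjT[OF a] adjQ Re_cinner_projection_onto[OF proj], simp)
  next
    fix U
    assume U: "U \<in> self_adjoint_part B" and upper: "\<forall>T\<in>D. op_le T U"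
    have adjU: "adj U = U"
      using U by (simp add: self_adjoint_part_def)
    have "(norm (bop_apply Q x))\<^sup>2 \<le> Re (cinner x (bop_apply U x))" for x
    proof (rule field_le_epsilon)
      fix e :: real
      assume "e > 0"
      let ?q = "bop_apply Q x"
      have "e / (norm ?q + 1) > 0"
        using \<open>e > 0\<close> by (simp add: add_nonneg_pos)
      moreover have "?q \<in> null_range"
        using Q by (simp add: projection_onto_def)
      ultimately obtain a where a: "a \<in> positive_null"
        and small: "norm (bop_apply (resolvent a) ?q) < e / (norm ?q + 1)"
        unfolding null_range_def by blast
      have "Re (cinner ?q (bop_apply (resolvent a) ?q)) \<le> norm ?q * norm (bop_apply (resolvent a) ?q)"
        by (rule Re_cinner_le)
      also have "\<dots> \<le> (norm ?q + 1) * (e / (norm ?q + 1))"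
        using small by (intro mult_mono) simp_all
      also have "\<dots> = e"
        by (simp add: add_nonneg_eq_0_iff)
      finally have "Re (cinner ?q (bop_apply (resolvent a) ?q)) \<le> e" .
      moreover have "op_le (1 - resolvent a) U"
        using upper a by (simp add: D_def)
      then have "Re (cinner x (bop_apply (1 - resolvent a) x)) \<le> Re (cinner x (bop_apply U x))"
        by (subst (asm) op_le_iff_Re[OF adjT[OF a] adjU]) blast
      ultimately show "(norm ?q)\<^sup>2 \<le> Re (cinner x (bop_apply U x)) + e"
        using form[OF a, of x] by linarith
    qed
    then show "op_le Q U"
      by (subst op_le_iff_Re[OF adjQ adjU]) (simp add: Re_cinner_projection_onto[OF proj])
  qed
  moreover have "D \<subseteq> self_adjoint_part B"
    using adjT resolvent_in positive_nullD null_ideal_subset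
    by (auto simp: D_def self_adjoint_part_def intro!: star_closed)
  moreover have "D \<noteq> {}"
    using positive_null_zero by (auto simp: D_def)
  moreover have "\<forall>T\<in>D. \<forall>U\<in>D. \<exists>W\<in>D. op_le T W \<and> op_le U W"
  proof (intro ballI)
    fix T U
    assume "T \<in> D" "U \<in> D"
    then obtain a b where a: "a \<in> positive_null" "T = 1 - resolvent a"
      and b: "b \<in> positive_null" "U = 1 - resolvent b"
      by (auto simp: D_def)
    have "op_le (1 - resolvent c) (1 - resolvent (c + d))"
      if "c \<in> positive_null" "d \<in> positive_null" for c d
      using resolvent_sum_le[OF that]
      by (subst op_le_iff_Re[OF adjT[OF that(1)] adjT[OF positive_null_add[OF that]]])
        (simp add: cinner_diff_right)
    from this[of a b] this[of b a] have "op_le T (1 - resolvent (a + b)) \<and> op_le U (1 - resolvent (a + b))"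
      using a b by (simp add: add.commute)
    then show "\<exists>W\<in>D. op_le T W \<and> op_le U W"
      using positive_null_add[OF a(1) b(1)] by (auto simp: D_def)
  qed
  ultimately have lub: "op_lub C (\<xi> ` D) (\<xi> Q)"
    using normal unfolding normal_map_def by blast
  have "\<xi> T = 0" if TD: "T \<in> D" for T
  proof -
    obtain a where a: "a \<in> positive_null" and T: "T = 1 - resolvent a"
      using TD by (auto simp: D_def)
    show ?thesis
      unfolding T one_minus_resolvent(1)[OF positive_nullD(2)[OF a]]
      using a by (intro map_mult_null resolvent_in positive_nullD null_ideal_subset)
  qed
  then have "\<xi> ` D = {0}"
    using \<open>D \<noteq> {}\<close> by auto
  moreover have "0 \<in> self_adjoint_part C"
    using unital_star_subalgebraD(2)[OF starC] by (simp add: self_adjoint_part_def)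
  moreover have "op_le (0 :: 'b bop) 0"
    by (simp add: op_le_def)
  ultimately have "\<xi> Q = 0"
    using lub unfolding op_lub_def by (intro op_le_antisym) auto
  then have "Q \<in> null_ideal B \<xi>"
    using QB adjQ QQ by (simp add: null_ideal_def)
  moreover have "X * Q = X" if X: "X \<in> null_ideal B \<xi>" for X
  proof (rule bop_eqI)
    fix x
    let ?y = "x - bop_apply Q x"
    have "cinner (bop_apply (adj X * X) ?y) ?y = 0"
      using Q range_positive_null[OF positive_null_adj_mult[OF X]] by (simp add: projection_onto_def)
    then have "cinner (bop_apply X ?y) (bop_apply X ?y) = 0"
      by (simp add: cinner_adj_left)
    then show "bop_apply (X * Q) x = bop_apply X x"
      by (simp add: cinner_self bop_apply_diff)
  qed
  ultimately show thesis
    by (rule that)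
qed

end

section \<open>Rigidity at a cyclic vector\<close>

lemma norm_sum_cinner_le:
  "cmod (\<Sum>k\<in>I. cinner (p k) (q k)) \<le> sqrt (\<Sum>k\<in>I. (norm (p k))\<^sup>2) * sqrt (\<Sum>k\<in>I. (norm (q k))\<^sup>2)"
proof -
  have "cmod (\<Sum>k\<in>I. cinner (p k) (q k)) \<le> (\<Sum>k\<in>I. \<bar>norm (p k)\<bar> * \<bar>norm (q k)\<bar>)"
    by (intro order_trans[OF norm_sum] sum_mono) (simp add: cinner_Cauchy_Schwarz)
  also have "\<dots> \<le> sqrt (\<Sum>k\<in>I. (norm (p k))\<^sup>2) * sqrt (\<Sum>k\<in>I. (norm (q k))\<^sup>2)"
    using L2_set_mult_ineq[of "\<lambda>k. norm (p k)" "\<lambda>k. norm (q k)" I] by (simp add: L2_set_def)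
  finally show ?thesis .
qed

lemma adj_one: "adj (1 :: 'a::unital_cstar_algebra) = 1"
  using adj_mult[of "adj 1" "1 :: 'a"] by (simp add: adj_adj)

lemma adj_zero: "adj (0 :: 'a::unital_cstar_algebra) = 0"
  using adj_add[of 0 "0 :: 'a"] by simp

text \<open>The orbit of a vector under a representation of the whole algebra is already a subspace, so
  single elements suffice in place of linear combinations.\<close>

lemma cyclic_vector_approx:
  fixes \<pi> :: "'a::unital_cstar_algebra \<Rightarrow> 'k::chilbert_space bop"
  assumes rep: "unital_star_representation \<pi>" and cyclic: "cyclic_vector \<pi> v" and "e > 0"
  obtains Y where "norm (bop_apply (\<pi> Y) v - w) < e"
proof -
  define S where "S = range (\<lambda>X. bop_apply (\<pi> X) v)"
  have add: "\<pi> (X + Y) = \<pi> X + \<pi> Y" and scale: "\<pi> (c *\<^sub>C X) = c *\<^sub>C \<pi> X" for X Y c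
    using rep by (simp_all add: unital_star_representation_def clinear_on_def)
  have "complex_vector.subspace S"
  proof (rule complex_vector.subspaceI)
    have "\<pi> 0 = 0"
      using scale[of 0 0] by simp
    then show "0 \<in> S"
      unfolding S_def by (intro range_eqI[of _ _ 0]) simp
    show "x + y \<in> S" if "x \<in> S" "y \<in> S" for x y
      using that unfolding S_def by (auto intro: range_eqI[of _ _ "_ + _"] simp: add)
    show "c *\<^sub>C x \<in> S" if "x \<in> S" for c x
      using that unfolding S_def by (auto intro: range_eqI[of _ _ "_ *\<^sub>C _"] simp: scale)
  qed
  then have span: "cspan S = S"
    by simp
  have S: "S = {bop_apply (\<pi> X) v | X. True}"
    by (auto simp: S_def)
  have "closure (cspan S) = UNIV"
    using cyclic unfolding cyclic_vector_def S .
  then have "w \<in> closure S"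
    by (simp add: span)
  then obtain y where "y \<in> S" "dist y w < e"
    using \<open>e > 0\<close> unfolding closure_approachable by blast
  then show thesis
    using that by (auto simp: S_def dist_norm)
qed

lemma stinespring_cinner:
  assumes "minimal_stinespring \<phi> \<pi> V"
  shows "cinner g (bop_apply (\<phi> X) h) = cinner (V g) (bop_apply (\<pi> X) (V h))"
  using assms by (simp add: minimal_stinespring_def cinner_cadjoint_right)

text \<open>For \<open>Y\<close> with \<open>\<pi> Y (V h)\<close> close to \<open>V g\<close>, both \<open>\<langle>g', \<phi> X g\<rangle>\<close> and \<open>\<langle>g', \<psi> X g\<rangle>\<close> are close to
  \<open>\<langle>g', \<phi> (X * Y) h\<rangle> = \<langle>g', \<psi> (X * Y) h\<rangle>\<close>: the former by continuity of \<open>\<pi> X\<close>, the latter by the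
  Cauchy-Schwarz inequality for the Gram factorisation of \<open>\<psi>\<close> on \<open>X\<^sup>*\<close>, \<open>Y\<close>, \<open>1\<close>.\<close>

lemma cp_eq_of_cyclic_vector:
  fixes \<phi> \<psi> :: "'a::unital_cstar_algebra \<Rightarrow> 'h::chilbert_space bop"
    and \<pi> :: "'a \<Rightarrow> 'k::chilbert_space bop"
  assumes st: "minimal_stinespring \<phi> \<pi> V" and cp: "completely_positive UNIV N \<psi>"
    and one: "\<phi> 1 = \<psi> 1" and cyclic: "cyclic_vector \<pi> (V h)"
    and eq: "\<And>X. bop_apply (\<phi> X) h = bop_apply (\<psi> X) h"
  shows "\<phi> = \<psi>"
proof (intro ext bop_eqI_cinner)
  fix X g' g
  have rep: "unital_star_representation \<pi>"
    using st by (simp add: minimal_stinespring_def)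
  then have \<pi>_mult: "\<pi> (X * Y) = \<pi> X * \<pi> Y" and \<pi>_adj: "\<pi> (adj X) = adj (\<pi> X)"
    and \<pi>_one: "\<pi> 1 = 1" for X Y
    by (simp_all add: unital_star_representation_def)
  note form = stinespring_cinner[OF st]
  \<comment> \<open>The factorisation below depends on \<open>Y\<close>, but this constant, the norm of \<open>X\<^sup>* \<otimes> g'\<close>, does not.\<close>
  define c where "c = sqrt (Re (cinner g' (bop_apply (\<psi> (X * adj X)) g')))"
  define d where "d = norm (bop_apply (adj (\<pi> X)) (V g'))"
  have d0: "0 \<le> d"
    by (simp add: d_def)
  have est: "0 \<le> c \<and> cmod (cinner g' (bop_apply (\<phi> X) g) - cinner g' (bop_apply (\<psi> X) g))
      \<le> (c + d) * norm (bop_apply (\<pi> Y) (V h) - V g)" for Y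
  proof -
    let ?\<delta> = "norm (bop_apply (\<pi> Y) (V h) - V g)"
    define Z where "Z i = (if i = 0 then adj X else if i = 1 then Y else 1)" for i :: nat
    obtain W where W: "\<And>i j. i < 3 \<Longrightarrow> j < 3 \<Longrightarrow> \<psi> (adj (Z i) * Z j) = (\<Sum>k<3::nat. adj (W k i) * W k j)"
      by (rule completely_positive_gram[OF cp UNIV_I adj_zero, of 3 Z]) auto
    have gram: "cinner u (bop_apply (\<psi> (adj (Z i) * Z j)) v)
        = (\<Sum>k<3::nat. cinner (bop_apply (W k i) u) (bop_apply (W k j) v))" if "i < 3" "j < 3" for i j u v
      by (simp add: W[OF that] bop_apply_sum cinner_sum_right cinner_adj_right)
    \<comment> \<open>These represent \<open>X\<^sup>* \<otimes> g'\<close>, \<open>Y \<otimes> h\<close> and \<open>1 \<otimes> g\<close> in the dilation of \<open>\<psi>\<close>.\<close>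
    define p where "p k = bop_apply (W k 0) g'" for k
    define q where "q k = bop_apply (W k 1) h" for k
    define r where "r k = bop_apply (W k 2) g" for k
    have pp: "(\<Sum>k<3::nat. (norm (p k))\<^sup>2) = Re (cinner g' (bop_apply (\<psi> (X * adj X)) g'))"
      using gram[of 0 0 g' g'] by (simp add: Z_def adj_adj p_def norm_square_eq_Re_cinner flip: Re_sum)
    have pq: "(\<Sum>k<3::nat. cinner (p k) (q k)) = cinner (V g') (bop_apply (\<pi> (X * Y)) (V h))"
      using gram[of 0 1 g' h] by (simp add: Z_def adj_adj p_def q_def form[symmetric] eq)
    have pr: "(\<Sum>k<3::nat. cinner (p k) (r k)) = cinner g' (bop_apply (\<psi> X) g)"
      using gram[of 0 2 g' g] by (simp add: Z_def adj_adj p_def r_def)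
    have qq: "(\<Sum>k<3::nat. (norm (q k))\<^sup>2) = (norm (bop_apply (\<pi> Y) (V h)))\<^sup>2"
      using gram[of 1 1 h h] form[of h "adj Y * Y" h]
      by (simp add: Z_def q_def norm_square_eq_Re_cinner eq \<pi>_mult \<pi>_adj cinner_adj_right
          flip: Re_sum)
    have rr: "(\<Sum>k<3::nat. (norm (r k))\<^sup>2) = (norm (V g))\<^sup>2"
      using gram[of 2 2 g g] form[of g 1 g]
      by (simp add: Z_def r_def norm_square_eq_Re_cinner one[symmetric] \<pi>_one adj_one flip: Re_sum)
    have rq: "(\<Sum>k<3::nat. Re (cinner (q k) (r k))) = Re (cinner (bop_apply (\<pi> Y) (V h)) (V g))"
    proof -
      have "(\<Sum>k<3::nat. Re (cinner (q k) (r k))) = Re (\<Sum>k<3::nat. cinner (r k) (q k))"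
        unfolding Re_sum by (rule sum.cong[OF refl]) (rule Re_cinner_commute)
      also have "\<dots> = Re (cinner (V g) (bop_apply (\<pi> Y) (V h)))"
        using gram[of 2 1 g h] form[of g Y h] by (simp add: Z_def q_def r_def eq adj_one flip: Re_sum)
      finally show ?thesis
        unfolding Re_cinner_commute[of "V g" "bop_apply (\<pi> Y) (V h)"] .
    qed
    have "(\<Sum>k<3::nat. (norm (q k - r k))\<^sup>2)
        = (\<Sum>k<3::nat. (norm (q k))\<^sup>2) + (\<Sum>k<3::nat. (norm (r k))\<^sup>2) - 2 * (\<Sum>k<3::nat. Re (cinner (q k) (r k)))"
      by (simp only: norm_diff_square sum.distrib sum_subtractf sum_distrib_left)
    also have "\<dots> = ?\<delta>\<^sup>2"
      by (simp only: qq rr rq norm_diff_square)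
    finally have \<delta>: "sqrt (\<Sum>k<3::nat. (norm (q k - r k))\<^sup>2) = ?\<delta>"
      by simp
    have "cmod (\<Sum>k<3::nat. cinner (p k) (q k - r k)) \<le> c * ?\<delta>"
      using norm_sum_cinner_le[of p "\<lambda>k. q k - r k" "{..<3::nat}"] by (simp only: \<delta> pp c_def)
    then have 1: "cmod (cinner (V g') (bop_apply (\<pi> (X * Y)) (V h)) - cinner g' (bop_apply (\<psi> X) g)) \<le> c * ?\<delta>"
      by (simp only: cinner_diff_right sum_subtractf pq pr)
    have "cinner g' (bop_apply (\<phi> X) g) - cinner (V g') (bop_apply (\<pi> (X * Y)) (V h))
        = - cinner (bop_apply (adj (\<pi> X)) (V g')) (bop_apply (\<pi> Y) (V h) - V g)"
      by (simp add: form \<pi>_mult cinner_adj_left bop_apply_diff cinner_diff_right)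
    then have 2: "cmod (cinner g' (bop_apply (\<phi> X) g) - cinner (V g') (bop_apply (\<pi> (X * Y)) (V h))) \<le> d * ?\<delta>"
      using cinner_Cauchy_Schwarz[of "bop_apply (adj (\<pi> X)) (V g')" "bop_apply (\<pi> Y) (V h) - V g"]
      by (simp add: d_def)
    have "cmod (cinner g' (bop_apply (\<phi> X) g) - cinner g' (bop_apply (\<psi> X) g)) \<le> d * ?\<delta> + c * ?\<delta>"
      using norm_triangle_mono[OF 2 1] by simp
    moreover have "0 \<le> c"
      unfolding c_def pp[symmetric] by (intro real_sqrt_ge_zero sum_nonneg) simp
    ultimately show ?thesis
      by (simp add: distrib_right add.commute)
  qed
  have "cmod (cinner g' (bop_apply (\<phi> X) g) - cinner g' (bop_apply (\<psi> X) g)) \<le> e" if "e > 0" for e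
  proof -
    have cd: "0 \<le> c + d"
      using est d0 by (simp add: add_nonneg_nonneg)
    then have "e / (c + d + 1) > 0"
      using that by simp
    then obtain Y where Y: "norm (bop_apply (\<pi> Y) (V h) - V g) < e / (c + d + 1)"
      by (rule cyclic_vector_approx[OF rep cyclic])
    have "(c + d) * norm (bop_apply (\<pi> Y) (V h) - V g) \<le> (c + d + 1) * (e / (c + d + 1))"
      using Y cd by (intro mult_mono) simp_all
    then show ?thesis
      using est[of Y] cd by simp
  qed
  then have "cmod (cinner g' (bop_apply (\<phi> X) g) - cinner g' (bop_apply (\<psi> X) g)) \<le> 0"
    by (rule field_le_epsilon) simp
  then show "cinner g' (bop_apply (\<phi> X) g) = cinner g' (bop_apply (\<psi> X) g)"
    by simp
qed

theorem corollary4p6: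
  fixes B :: "'h::chilbert_space bop set"
    and C :: "'g::chilbert_space bop set"
    and \<xi> :: "'h bop \<Rightarrow> 'g bop"
    and \<phi> \<psi> :: "'a::unital_cstar_algebra \<Rightarrow> 'h bop"
  assumes "von_neumann_algebra B"
    and "von_neumann_algebra C"
    and "completely_positive B C \<xi>"
    and "normal_map B C \<xi>"
    and "\<exists>X\<in>B. \<xi> X \<noteq> 0"
    and "completely_positive UNIV B \<phi>"
    and "completely_positive UNIV B \<psi>"
    and "quasi_pure TYPE('k::chilbert_space) \<phi>"
    and "\<exists>X. \<xi> (\<phi> X) \<noteq> 0"
    and "\<phi> 1 = \<psi> 1"
    and "equal_ae B \<xi> \<phi> \<psi>"
  shows "\<phi> = \<psi>"
proof -
  interpret normal_cp_on_von_neumann_algebra B C \<xi>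
    using assms(1-4) by unfold_locales (simp_all add: von_neumann_algebra_def)
  obtain Q where Q: "Q \<in> null_ideal B \<xi>" and supp: "\<And>X. X \<in> null_ideal B \<xi> \<Longrightarrow> X * Q = X"
    by (rule support_projection_exists) blast
  obtain \<pi> :: "'a \<Rightarrow> 'k bop" and V where st: "minimal_stinespring \<phi> \<pi> V"
    and qp: "\<And>g. g \<in> range V \<Longrightarrow> g \<noteq> 0 \<Longrightarrow> cyclic_vector \<pi> g"
    using assms(8) unfolding quasi_pure_def by blast
  \<comment> \<open>Otherwise every \<open>\<phi> X\<close> would factor through \<open>Q\<close> and \<open>\<xi> \<circ> \<phi>\<close> would vanish.\<close>
  have "\<exists>h. V (h - bop_apply Q h) \<noteq> 0"
  proof (rule ccontr)
    assume "\<not> ?thesis"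
    then have V0: "V (h - bop_apply Q h) = 0" for h
      by blast
    have "\<xi> (\<phi> X) = 0" for X
    proof -
      have "bop_apply (\<phi> X) (h - bop_apply Q h) = 0" for h
        by (rule cinner_ext) (simp add: stinespring_cinner[OF st] V0)
      then have "\<phi> X * Q = \<phi> X"
        by (intro bop_eqI) (simp add: bop_apply_diff)
      moreover have "\<phi> X \<in> B"
        using assms(6) by (auto simp: completely_positive_def)
      ultimately show ?thesis
        using map_mult_null[OF Q, of "\<phi> X"] by simp
    qed
    with assms(9) show False
      by simp
  qed
  then obtain h where h: "V (h - bop_apply Q h) \<noteq> 0" ..
  show ?thesis
  proof (rule cp_eq_of_cyclic_vector[OF st assms(7,10)])
    show "cyclic_vector \<pi> (V (h - bop_apply Q h))"
      using h by (intro qp) simp_all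
    fix X
    have "(\<phi> X - \<psi> X) * Q = \<phi> X - \<psi> X"
      using assms(11) by (intro supp) (simp add: equal_ae_def)
    from arg_cong[OF this, of "\<lambda>T. bop_apply T h"]
    have "bop_apply (\<phi> X - \<psi> X) (h - bop_apply Q h) = 0"
      by (simp only: bop_apply_diff bop_apply_simps(5)) simp
    then show "bop_apply (\<phi> X) (h - bop_apply Q h) = bop_apply (\<psi> X) (h - bop_apply Q h)"
      by simp
  qed
qed

end
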